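(* Let $X \subset \mathbb{P}^n$ be an irreducible nondegenerate projective variety over an algebraically closed field of characteristic zero. Let $r_{\mathrm{gen}}$ and $r_{\mathrm{max}}$ be the generic rank and the maximum rank with respect to $X$. Suppose $X$ is not a hypersurface, but for some $r$ the secant variety $\sigma_r(X)$ is a hypersurface in $\mathbb{P}^n$; necessarily $r = r_{\mathrm{gen}} - 1$. Then $$r_{\mathrm{max}} \leq 2r+1 = 2 r_{\mathrm{gen}} - 1.$$ If, moreover, the hypersurface $\sigma_r(X)$ has no points of multiplicity equal to $\deg(\sigma_r(X)) - 1$, then $$r_{\mathrm{max}} \leq 2r = 2 r_{\mathrm{gen}} - 2.$$
   Context: Let $\mathbb{F}$ be the base field and let $\hat{X} \subset \mathbb{F}^{n+1}$ be the affine cone over $X$. $X$ is nondegenerate if it is not contained in a hyperplane. For nonzero $v \in \mathbb{F}^{n+1}$, the rank of $v$ with respect to $X$ is the least $r$ such that $v = x_1 + \dotsb + x_r$ with all $x_i \in \hat X$; the rank of a point of $\mathbb{P}^n$ is the rank of any nonzero vector representing it. The maximum rank $r_{\mathrm{max}}$ is the maximum of the rank over all points of $\mathbb{P}^n$. The generic rank $r_{\mathrm{gen}}$ is the unique $r$ such that the set of vectors of rank equal to $r$ contains a nonempty Zariski open subset of $\mathbb{F}^{n+1}$. For $r \geq 1$, the $r$-th secant variety $\sigma_r(X) \subset \mathbb{P}^n$ is the Zariski closure of the set of points of rank at most $r$. *)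

theory Defs
  imports
    "HOL-Analysis.Analysis"
    "HOL-Computational_Algebra.Polynomial"
    "HOL-Library.Poly_Mapping"
begin

section \<open>Polynomials in the coordinates indexed by \<open>'n\<close>\<close>

text \<open>
  A finite type \<open>'n\<close> with \<open>n + 1\<close> elements indexes the homogeneous coordinates of projective
  \<open>n\<close>-space. A polynomial maps exponent vectors to coefficients, with finite support; the ring
  structure (and hence \<open>dvd\<close>) is the convolution product of \<^theory>\<open>HOL-Library.Poly_Mapping\<close>.
\<close>

type_synonym ('a, 'n) mpoly = "('n \<Rightarrow>\<^sub>0 nat) \<Rightarrow>\<^sub>0 'a"

definition mpoly_const :: "'a::zero \<Rightarrow> ('a, 'n) mpoly" where
  "mpoly_const c = Poly_Mapping.single 0 c"

definition mpoly_var :: "'n \<Rightarrow> ('a::zero_neq_one, 'n) mpoly" where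
  "mpoly_var i = Poly_Mapping.single (Poly_Mapping.single i 1) 1"

definition monom_degree :: "('n::finite \<Rightarrow>\<^sub>0 nat) \<Rightarrow> nat" where
  "monom_degree m = (\<Sum>i\<in>UNIV. Poly_Mapping.lookup m i)"

definition mpoly_degree :: "('a::zero, 'n::finite) mpoly \<Rightarrow> nat" where
  "mpoly_degree f = Max (monom_degree ` Poly_Mapping.keys f)"

definition homogeneous_mpoly :: "nat \<Rightarrow> ('a::zero, 'n::finite) mpoly \<Rightarrow> bool" where
  "homogeneous_mpoly d f \<longleftrightarrow> (\<forall>m\<in>Poly_Mapping.keys f. monom_degree m = d)"

definition mpoly_subst ::
    "('a::zero \<Rightarrow> 'b::comm_semiring_1) \<Rightarrow> ('n::finite \<Rightarrow> 'b) \<Rightarrow> ('a, 'n) mpoly \<Rightarrow> 'b" where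
  "mpoly_subst \<phi> \<sigma> f =
    (\<Sum>m\<in>Poly_Mapping.keys f.
      \<phi> (Poly_Mapping.lookup f m) * (\<Prod>i\<in>UNIV. \<sigma> i ^ Poly_Mapping.lookup m i))"

definition mpoly_eval :: "('a::comm_semiring_1, 'n::finite) mpoly \<Rightarrow> 'a ^ 'n \<Rightarrow> 'a" where
  "mpoly_eval f v = mpoly_subst (\<lambda>c. c) (\<lambda>i. v $ i) f"

text \<open>The Taylor expansion of \<open>f\<close> at \<open>v\<close>, that is, the polynomial \<open>f (v + x)\<close> in \<open>x\<close>.\<close>

definition taylor_shift ::
    "'a ^ 'n \<Rightarrow> ('a::comm_semiring_1, 'n::finite) mpoly \<Rightarrow> ('a, 'n) mpoly" where
  "taylor_shift v f = mpoly_subst mpoly_const (\<lambda>i. mpoly_const (v $ i) + mpoly_var i) f"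

text \<open>Only meaningful for \<open>f \<noteq> 0\<close>, whose order of vanishing is finite.\<close>

definition vanishing_order :: "('a::comm_semiring_1, 'n::finite) mpoly \<Rightarrow> 'a ^ 'n \<Rightarrow> nat" where
  "vanishing_order f v = Min (monom_degree ` Poly_Mapping.keys (taylor_shift v f))"


section \<open>Projective space and its Zariski topology\<close>

text \<open>
  A point of projective space is a one-dimensional subspace, given as the set of its vectors
  (zero included).
\<close>

definition projective_space :: "('a::field ^ 'n::finite) set set" where
  "projective_space = {vec.span {v} | v. v \<noteq> 0}"

definition point_rep :: "('a::field ^ 'n::finite) set \<Rightarrow> 'a ^ 'n" where
  "point_rep p = (SOME v. v \<in> p \<and> v \<noteq> 0)"

definition affine_cone :: "('a::field ^ 'n::finite) set set \<Rightarrow> ('a ^ 'n) set" where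
  "affine_cone X = insert 0 (\<Union>X)"

definition affine_closed :: "('a::field ^ 'n::finite) set \<Rightarrow> bool" where
  "affine_closed Z \<longleftrightarrow>
    (\<exists>S :: ('a, 'n) mpoly set. Z = {v. \<forall>f\<in>S. mpoly_eval f v = 0})"

definition projective_zeros ::
    "('a::field, 'n::finite) mpoly set \<Rightarrow> ('a ^ 'n) set set" where
  "projective_zeros S = {p \<in> projective_space. \<forall>f\<in>S. \<forall>v\<in>p. v \<noteq> 0 \<longrightarrow> mpoly_eval f v = 0}"

definition projective_closed :: "('a::field ^ 'n::finite) set set \<Rightarrow> bool" where
  "projective_closed Z \<longleftrightarrow>
    (\<exists>S. (\<forall>f\<in>S. \<exists>d. homogeneous_mpoly d f) \<and> Z = projective_zeros S)"

definition irreducible_projective_variety :: "('a::field ^ 'n::finite) set set \<Rightarrow> bool" where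
  "irreducible_projective_variety X \<longleftrightarrow>
    projective_closed X \<and> X \<noteq> {} \<and>
    (\<forall>A B. projective_closed A \<longrightarrow> projective_closed B \<longrightarrow> X \<subseteq> A \<union> B \<longrightarrow> X \<subseteq> A \<or> X \<subseteq> B)"

definition projective_hyperplane :: "('a::field ^ 'n::finite) set set \<Rightarrow> bool" where
  "projective_hyperplane H \<longleftrightarrow>
    (\<exists>a. a \<noteq> 0 \<and> H = {p \<in> projective_space. \<forall>v\<in>p. (\<Sum>i\<in>UNIV. a $ i * v $ i) = 0})"

definition nondegenerate :: "('a::field ^ 'n::finite) set set \<Rightarrow> bool" where
  "nondegenerate X \<longleftrightarrow> (\<nexists>H. projective_hyperplane H \<and> X \<subseteq> H)"


section \<open>Hypersurfaces, degree and multiplicity\<close>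

definition projective_hypersurface :: "('a::field ^ 'n::finite) set set \<Rightarrow> bool" where
  "projective_hypersurface H \<longleftrightarrow>
    (\<exists>d f. d \<ge> 1 \<and> homogeneous_mpoly d f \<and> f \<noteq> 0 \<and> H = projective_zeros {f})"

definition vanishing_ideal :: "('a::field ^ 'n::finite) set set \<Rightarrow> ('a, 'n) mpoly set" where
  "vanishing_ideal H = {g. \<forall>v\<in>affine_cone H. mpoly_eval g v = 0}"

text \<open>
  The degree and the multiplicities of a hypersurface are those of its reduced equation: a
  homogeneous generator of the ideal of the hypersurface, which is unique up to a nonzero
  constant. As that equation is homogeneous, its order of vanishing at a nonzero vector depends
  only on the point of projective space spanned by the vector.
\<close>

definition reduced_equation :: "('a::field ^ 'n::finite) set set \<Rightarrow> ('a, 'n) mpoly" where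
  "reduced_equation H =
    (SOME f. (\<exists>d. homogeneous_mpoly d f) \<and> vanishing_ideal H = {g. f dvd g})"

definition hypersurface_degree :: "('a::field ^ 'n::finite) set set \<Rightarrow> nat" where
  "hypersurface_degree H = mpoly_degree (reduced_equation H)"

definition hypersurface_multiplicity ::
    "('a::field ^ 'n::finite) set set \<Rightarrow> ('a ^ 'n) set \<Rightarrow> nat" where
  "hypersurface_multiplicity H p = vanishing_order (reduced_equation H) (point_rep p)"


section \<open>Rank with respect to a projective variety\<close>

text \<open>
  If \<open>X\<close> is nondegenerate then its affine cone spans the whole space, so every vector is a sum
  of cone elements and the minimum below is attained.
\<close>

definition vector_rank :: "('a::field ^ 'n::finite) set set \<Rightarrow> 'a ^ 'n \<Rightarrow> nat" where
  "vector_rank X v =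
    (LEAST r. \<exists>xs. length xs = r \<and> set xs \<subseteq> affine_cone X \<and> v = sum_list xs)"

definition point_rank :: "('a::field ^ 'n::finite) set set \<Rightarrow> ('a ^ 'n) set \<Rightarrow> nat" where
  "point_rank X p = vector_rank X (point_rep p)"

definition max_rank :: "('a::field ^ 'n::finite) set set \<Rightarrow> nat" where
  "max_rank X = Max (point_rank X ` projective_space)"

definition generic_rank :: "('a::field ^ 'n::finite) set set \<Rightarrow> nat" where
  "generic_rank X =
    (THE r. \<exists>U. affine_closed (- U) \<and> U \<noteq> {} \<and> U \<subseteq> {v. v \<noteq> 0 \<and> vector_rank X v = r})"

definition secant_variety ::
    "('a::field ^ 'n::finite) set set \<Rightarrow> nat \<Rightarrow> ('a ^ 'n) set set" where
  "secant_variety X r = projective_closed hull {p \<in> projective_space. point_rank X p \<le> r}"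


text \<open>The rank of a point does not depend on the representing vector.\<close>

lemma affine_cone_scale:
  assumes "X \<subseteq> projective_space" "x \<in> affine_cone X"
  shows "c *s x \<in> affine_cone X"
proof (cases "x = 0")
  case False
  with assms(2) obtain p where p: "p \<in> X" "x \<in> p"
    by (auto simp: affine_cone_def)
  with assms(1) obtain v where "p = vec.span {v}"
    by (auto simp: projective_space_def)
  with p have "c *s x \<in> p"
    by (simp add: vec.span_scale)
  with p(1) show ?thesis
    by (auto simp: affine_cone_def)
qed (simp add: affine_cone_def)

lemma sum_list_scale:
  fixes xs :: "('a::field ^ 'n::finite) list"
  shows "sum_list (map ((*s) c) xs) = c *s sum_list xs"
  by (induction xs) (simp_all add: vec.scale_right_distrib)

lemma vector_rank_scale:
  assumes X: "X \<subseteq> projective_space" and c: "c \<noteq> 0"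
  shows "vector_rank X (c *s v) = vector_rank X v"
proof -
  let ?P = "\<lambda>v r. \<exists>xs. length xs = r \<and> set xs \<subseteq> affine_cone X \<and> v = sum_list xs"
  have scale: "?P (d *s w) r" if "?P w r" for d w r
  proof -
    from that obtain xs where
      "length xs = r" "set xs \<subseteq> affine_cone X" "w = sum_list xs"
      by blast
    then show ?thesis
      using affine_cone_scale[OF X, of _ d]
      by (intro exI[of _ "map ((*s) d) xs"]) (auto simp: sum_list_scale)
  qed
  have "?P (c *s v) r \<longleftrightarrow> ?P v r" for r
    using scale[where w = "c *s v" and r = r and d = "inverse c"]
      scale[where w = v and r = r and d = c] c by auto
  then show ?thesis
    by (simp add: vector_rank_def)
qed

lemma point_rank_eq_vector_rank:
  assumes X: "X \<subseteq> projective_space" and p: "p \<in> projective_space" and v: "v \<in> p" "v \<noteq> 0"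
  shows "point_rank X p = vector_rank X v"
proof -
  have rep: "point_rep p \<in> p" "point_rep p \<noteq> 0"
    using someI[of "\<lambda>v. v \<in> p \<and> v \<noteq> 0" v] v by (auto simp: point_rep_def)
  from p obtain w where "p = vec.span {w}"
    by (auto simp: projective_space_def)
  with rep v obtain a b where ab: "point_rep p = a *s w" "v = b *s w" "a \<noteq> 0" "b \<noteq> 0"
    by (auto simp: vec.span_singleton)
  then show ?thesis
    by (simp add: point_rank_def vector_rank_scale[OF X])
qed

end

(*
  Let C be the affine cone over X and S_k the set of sums of k elements of C. The sets S_k are
  irreducible and contain a nonempty open subset of their closures (eliminate one coordinate at a
  time). The ideal of S_r is generated by one homogeneous f: an element of the ideal of minimal
  degree in a generic direction becomes monic after division by its leading coefficient, and this
  divisibility is tested on lines. An irreducible set containing S_r either lies in the zero set of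
  f or is dense; hence S_(r+1) is dense, as C spans the space.

  Given q, consider the lines s + t q with s in S_r. If f vanishes on all of them, then
  q = (s + q) - s for a generic s. Otherwise they sweep out a dense set, so some line meets the
  open part of S_(r+1), and q is in S_(2r+1). If q is not a point of multiplicity deg f - 1, then
  f(s + t q) has degree at least 2 in t and a simple root at t = 0 for generic s; a second root
  gives another point of S_r on the line, and q is in S_(2r).
*)

theory Submission
  imports Defs
begin

text \<open>Rank is a matter of the sets S_k themselves, density one of their closures; the open
  part of each S_k in its closure links the two. No dimension theory enters. Its place is taken by
  the generator f: along a direction where f has full degree, each division by f lowers the degree.
  That f generates the ideal, and does not merely cut out the closure, is needed a second time:
  forms of degree below deg f cannot vanish on S_r, so the coefficients of f(s + t q) in t are
  nonzero for generic s unless they vanish identically.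

  One tool serves both the elimination and the ideal: pseudo-division along a direction w, with
  polynomials read as polynomials in one coordinate whose coefficients are constant along w.

  The delicate point is the second root in the even bound. It depends on s, so genericity of s does
  not directly put it into the open part of S_r. The remedy is a function constant along q whose
  nonvanishing on the closure forces a point into the open part; it takes the same value at s and at
  the root.\<close>

section \<open>Polynomial functions and their restrictions to lines\<close>

inductive polyfun :: "('a::comm_ring_1 ^ 'n \<Rightarrow> 'a) \<Rightarrow> bool" where
  const: "polyfun (\<lambda>_. c)"
| coord: "polyfun (\<lambda>v. v $ i)"
| add: "polyfun f \<Longrightarrow> polyfun g \<Longrightarrow> polyfun (\<lambda>v. f v + g v)"
| mult: "polyfun f \<Longrightarrow> polyfun g \<Longrightarrow> polyfun (\<lambda>v. f v * g v)"

lemma polyfun_sum: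
  "(\<And>i. i \<in> A \<Longrightarrow> polyfun (f i)) \<Longrightarrow> polyfun (\<lambda>v. \<Sum>i\<in>A. f i v)"
  by (induction A rule: infinite_finite_induct) (auto intro: polyfun.intros)

lemma polyfun_prod:
  "(\<And>i. i \<in> A \<Longrightarrow> polyfun (f i)) \<Longrightarrow> polyfun (\<lambda>v. \<Prod>i\<in>A. f i v)"
  by (induction A rule: infinite_finite_induct) (auto intro: polyfun.intros)

lemma polyfun_power: "polyfun f \<Longrightarrow> polyfun (\<lambda>v. f v ^ k)"
  by (induction k) (auto intro: polyfun.intros)

lemma polyfun_minus: "polyfun f \<Longrightarrow> polyfun (\<lambda>v. - f v)"
  using polyfun.mult[OF polyfun.const[of "-1"]] by fastforce

lemma polyfun_diff: "polyfun f \<Longrightarrow> polyfun g \<Longrightarrow> polyfun (\<lambda>v. f v - g v)"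
  using polyfun.add[OF _ polyfun_minus] by fastforce

lemma polyfun_compose:
  assumes "polyfun f" "\<And>i. polyfun (\<lambda>x. V x $ i)"
  shows "polyfun (\<lambda>x. f (V x))"
  using assms by induction (auto intro: polyfun.intros)

lemmas polyfun_intros = polyfun.intros polyfun_sum polyfun_prod polyfun_power polyfun_minus
  polyfun_diff

lemma polyfun_translate: "polyfun f \<Longrightarrow> polyfun (\<lambda>v. f (v + u))"
  by (erule polyfun_compose) (auto intro: polyfun_intros)

lemma polyfun_translate': "polyfun f \<Longrightarrow> polyfun (\<lambda>v. f (u + v))"
  by (erule polyfun_compose) (auto intro: polyfun_intros)

lemma poly_eq_sum_bound:
  fixes p :: "'a::comm_ring_1 poly"
  assumes "degree p \<le> n"
  shows "poly p x = (\<Sum>i\<le>n. coeff p i * x ^ i)"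
  unfolding poly_altdef
  by (rule sum.mono_neutral_left) (use assms in \<open>auto simp: coeff_eq_0\<close>)

lemma polyfun_line:
  assumes "polyfun f"
  shows "\<exists>P. \<forall>t. poly P t = f (v + t *s w)"
  using assms
proof induction
  case (const c)
  show ?case by (rule exI[of _ "[:c:]"]) simp
next
  case (coord i)
  show ?case by (rule exI[of _ "[:v $ i, w $ i:]"]) (simp add: algebra_simps)
next
  case (add f g)
  then obtain P Q where "\<forall>t. poly P t = f (v + t *s w)" "\<forall>t. poly Q t = g (v + t *s w)" by auto
  then show ?case by (intro exI[of _ "P + Q"]) simp
next
  case (mult f g)
  then obtain P Q where "\<forall>t. poly P t = f (v + t *s w)" "\<forall>t. poly Q t = g (v + t *s w)" by auto
  then show ?case by (intro exI[of _ "P * Q"]) simp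
qed

definition line_poly :: "('a::comm_ring_1 ^ 'n \<Rightarrow> 'a) \<Rightarrow> 'a ^ 'n \<Rightarrow> 'a ^ 'n \<Rightarrow> 'a poly" where
  "line_poly f v w = (SOME P. \<forall>t. poly P t = f (v + t *s w))"

lemma poly_line_poly: "polyfun f \<Longrightarrow> poly (line_poly f v w) t = f (v + t *s w)"
  using someI_ex[OF polyfun_line, of f v w] unfolding line_poly_def by blast

text \<open>Characteristic zero makes the domain infinite, so values determine a polynomial. This
  turns the choice in \<open>line_poly\<close> into an operation compatible with sums and
  products.\<close>

lemma line_poly_unique:
  fixes f :: "'a::{idom, ring_char_0} ^ 'n \<Rightarrow> 'a"
  assumes "polyfun f" "\<And>t. poly P t = f (v + t *s w)"
  shows "line_poly f v w = P"
  using assms by (simp add: poly_eq_poly_eq_iff[symmetric] poly_line_poly fun_eq_iff)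

lemma line_poly_const: "line_poly (\<lambda>_. c :: 'a::{idom, ring_char_0}) v w = [:c:]"
  by (rule line_poly_unique) (auto intro: polyfun_intros)

lemma line_poly_coord: "line_poly (\<lambda>v. v $ i) v w = [:v $ i, w $ i :: 'a::{idom, ring_char_0}:]"
  by (rule line_poly_unique) (auto intro: polyfun_intros simp: algebra_simps)

lemma line_poly_add:
  "polyfun f \<Longrightarrow> polyfun g \<Longrightarrow>
    line_poly (\<lambda>v. f v + g v :: 'a::{idom, ring_char_0}) v w = line_poly f v w + line_poly g v w"
  by (rule line_poly_unique) (auto intro: polyfun_intros simp: poly_line_poly)

lemma line_poly_mult:
  "polyfun f \<Longrightarrow> polyfun g \<Longrightarrow>
    line_poly (\<lambda>v. f v * g v :: 'a::{idom, ring_char_0}) v w = line_poly f v w * line_poly g v w"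
  by (rule line_poly_unique) (auto intro: polyfun_intros simp: poly_line_poly)

text \<open>Induction on \<open>f\<close>, with the Cauchy product formula for products. Homogeneous
  components, expansions along a direction and derivatives along a direction are all read off these
  coefficients, so base point and direction may both vary.\<close>

lemma polyfun_coeff_line_poly:
  assumes "polyfun f" "\<And>i. polyfun (\<lambda>x. V x $ i)" "\<And>i. polyfun (\<lambda>x. W x $ i)"
  shows "polyfun (\<lambda>x. coeff (line_poly f (V x) (W x)) k :: 'a::{idom, ring_char_0})"
  using assms(1)
proof (induction arbitrary: k)
  case (const c)
  then show ?case by (auto simp: line_poly_const coeff_pCons split: nat.splits intro: polyfun_intros)
next
  case (coord i)
  have "polyfun (\<lambda>x. coeff [:V x $ i, W x $ i:] k)"
    by (cases k rule: nat.exhaust; cases "k - 1")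
      (auto simp: coeff_pCons assms intro: polyfun_intros split: nat.splits)
  then show ?case by (simp add: line_poly_coord)
next
  case (add f g)
  then show ?case by (auto simp: line_poly_add intro: polyfun_intros)
next
  case (mult f g)
  then show ?case by (auto simp: line_poly_mult coeff_mult intro!: polyfun_sum polyfun.mult)
qed

lemma degree_line_poly_bounded:
  assumes "polyfun (f :: 'a::{idom, ring_char_0} ^ 'n \<Rightarrow> 'a)"
  shows "\<exists>D. \<forall>v w. degree (line_poly f v w) \<le> D"
  using assms
proof induction
  case (const c)
  then show ?case by (auto simp: line_poly_const)
next
  case (coord i)
  then show ?case by (auto simp: line_poly_coord)
next
  case (add f g)
  then obtain D E where "\<forall>v w. degree (line_poly f v w) \<le> D" "\<forall>v w. degree (line_poly g v w) \<le> E"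
    by blast
  then have "degree (line_poly f v w) \<le> max D E" "degree (line_poly g v w) \<le> max D E" for v w
    by (auto simp: le_max_iff_disj)
  with add show ?case by (auto simp: line_poly_add intro!: exI[of _ "max D E"] degree_add_le)
next
  case (mult f g)
  then obtain D E where "\<forall>v w. degree (line_poly f v w) \<le> D" "\<forall>v w. degree (line_poly g v w) \<le> E"
    by blast
  with mult show ?case
    by (auto simp: line_poly_mult intro!: exI[of _ "D + E"] order_trans[OF degree_mult_le] add_mono)
qed

section \<open>Homogeneous components\<close>

definition homog :: "nat \<Rightarrow> ('a::comm_ring_1 ^ 'n \<Rightarrow> 'a) \<Rightarrow> bool" where
  "homog d f \<longleftrightarrow> (\<forall>c v. f (c *s v) = c ^ d * f v)"

text \<open>On the line through 0 and \<open>v\<close> the part of degree \<open>d\<close> scales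
  with the \<open>d\<close>-th power of the parameter, hence is a coefficient there.\<close>

definition homog_comp :: "nat \<Rightarrow> ('a::comm_ring_1 ^ 'n \<Rightarrow> 'a) \<Rightarrow> 'a ^ 'n \<Rightarrow> 'a" where
  "homog_comp d f v = coeff (line_poly f 0 v) d"

context
  fixes f :: "'a::{idom, ring_char_0} ^ 'n \<Rightarrow> 'a"
  assumes f: "polyfun f"
begin

lemma polyfun_homog_comp: "polyfun (homog_comp d f)"
  unfolding homog_comp_def[abs_def]
  by (rule polyfun_coeff_line_poly[OF f]) (auto intro: polyfun_intros)

lemma line_poly_scale: "line_poly f v (c *s w) = pcompose (line_poly f v w) [:0, c:]"
  by (rule line_poly_unique) (use f in \<open>auto simp: poly_pcompose poly_line_poly mult.commute\<close>)

lemma homog_homog_comp: "homog d (homog_comp d f)"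
  by (auto simp: homog_def homog_comp_def line_poly_scale coeff_pcompose_linear)

lemma homog_comp_sum: "\<exists>D. \<forall>v. f v = (\<Sum>j\<le>D. homog_comp j f v)"
proof -
  obtain D where D: "\<And>v w. degree (line_poly f v w) \<le> D"
    using degree_line_poly_bounded[OF f] by blast
  have "f v = (\<Sum>j\<le>D. homog_comp j f v)" for v
  proof -
    have "f v = poly (line_poly f 0 v) 1" using f by (simp add: poly_line_poly)
    also have "\<dots> = (\<Sum>j\<le>D. homog_comp j f v)"
      by (subst poly_eq_sum_bound[OF D]) (simp add: homog_comp_def)
    finally show ?thesis .
  qed
  then show ?thesis by blast
qed

end


section \<open>Irreducible sets\<close>

abbreviation vanishes_on :: "('a::comm_ring_1 ^ 'n \<Rightarrow> 'a) \<Rightarrow> ('a ^ 'n) set \<Rightarrow> bool" where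
  "vanishes_on f Z \<equiv> (\<forall>z\<in>Z. f z = 0)"

text \<open>The ideal of \<open>Z\<close> is prime. The set itself need not be closed, so images and
  sums can be treated directly.\<close>

definition irreducible_set :: "('a::comm_ring_1 ^ 'n) set \<Rightarrow> bool" where
  "irreducible_set Z \<longleftrightarrow> Z \<noteq> {} \<and>
    (\<forall>f g. polyfun f \<longrightarrow> polyfun g \<longrightarrow> vanishes_on (\<lambda>z. f z * g z) Z \<longrightarrow>
      vanishes_on f Z \<or> vanishes_on g Z)"

definition zariski_closure :: "('a::comm_ring_1 ^ 'n) set \<Rightarrow> ('a ^ 'n) set" where
  "zariski_closure Z = {v. \<forall>f. polyfun f \<longrightarrow> vanishes_on f Z \<longrightarrow> f v = 0}"

definition sumset :: "'a::plus set \<Rightarrow> 'a set \<Rightarrow> 'a set" where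
  "sumset A B = {a + b | a b. a \<in> A \<and> b \<in> B}"

lemma sumsetI: "a \<in> A \<Longrightarrow> b \<in> B \<Longrightarrow> a + b \<in> sumset A B"
  by (auto simp: sumset_def)

lemma zariski_closureD:
  "v \<in> zariski_closure Z \<Longrightarrow> polyfun f \<Longrightarrow> vanishes_on f Z \<Longrightarrow> f v = 0"
  by (auto simp: zariski_closure_def)

lemma subset_zariski_closure: "Z \<subseteq> zariski_closure Z"
  by (auto simp: zariski_closure_def)

lemma irreducible_setD:
  assumes "irreducible_set Z" "polyfun f" "polyfun g" "vanishes_on (\<lambda>z. f z * g z) Z"
  shows "vanishes_on f Z \<or> vanishes_on g Z"
  using assms unfolding irreducible_set_def by blast

lemma irreducible_set_nonempty: "irreducible_set Z \<Longrightarrow> Z \<noteq> {}"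
  by (simp add: irreducible_set_def)

lemma polyfun_if: "polyfun f \<Longrightarrow> polyfun g \<Longrightarrow> polyfun (\<lambda>v. if P then f v else g v)"
  by (cases P) simp_all

lemma irreducible_set_power:
  fixes Z :: "('a::idom ^ 'n) set"
  assumes "irreducible_set Z" "polyfun f" "vanishes_on (\<lambda>z. f z ^ k * g z) Z" "polyfun g"
    "\<not> vanishes_on f Z"
  shows "vanishes_on g Z"
  using assms(3)
proof (induction k)
  case (Suc k)
  have "vanishes_on (\<lambda>z. f z * (f z ^ k * g z)) Z"
    using Suc.prems by (simp add: mult.assoc)
  with irreducible_setD[OF assms(1,2) polyfun.mult[OF polyfun_power[OF assms(2)] assms(4)]] assms(5)
  show ?case using Suc.IH by blast
qed simp

lemma irreducible_set_mult:
  assumes "irreducible_set Z" "polyfun f" "polyfun g" "\<not> vanishes_on f Z" "\<not> vanishes_on g Z"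
  shows "\<not> vanishes_on (\<lambda>z. f z * g z) Z"
  using irreducible_setD[OF assms(1-3)] assms(4,5) by blast

lemma irreducible_set_image:
  assumes Z: "irreducible_set Z" and V: "\<And>i. polyfun (\<lambda>x. V x $ i)"
  shows "irreducible_set (V ` Z)"
  unfolding irreducible_set_def
proof (intro conjI allI impI)
  show "V ` Z \<noteq> {}" using Z by (auto simp: irreducible_set_def)
  fix f g assume f: "polyfun f" and g: "polyfun g" and fg: "vanishes_on (\<lambda>z. f z * g z) (V ` Z)"
  show "vanishes_on f (V ` Z) \<or> vanishes_on g (V ` Z)"
    using irreducible_setD[OF Z polyfun_compose[OF f V] polyfun_compose[OF g V]] fg by auto
qed

text \<open>For fixed \<open>b\<close> one factor vanishes on the whole translate of
  \<open>A\<close> by \<open>b\<close>. If neither factor vanished everywhere, irreducibility of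
  \<open>B\<close> would give one \<open>c\<close> at which both witnesses \<open>a\<close> and
  \<open>a'\<close> survive, against the first remark.\<close>

lemma irreducible_set_sumset:
  assumes A: "irreducible_set A" and B: "irreducible_set B"
  shows "irreducible_set (sumset A B)"
  unfolding irreducible_set_def
proof (intro conjI allI impI)
  show "sumset A B \<noteq> {}"
    using A B by (auto simp: irreducible_set_def sumset_def)
  fix f g assume f: "polyfun f" and g: "polyfun g"
    and fg: "vanishes_on (\<lambda>z. f z * g z) (sumset A B)"
  have *: "(\<forall>a\<in>A. f (a + b) = 0) \<or> (\<forall>a\<in>A. g (a + b) = 0)" if "b \<in> B" for b
    using irreducible_setD[OF A polyfun_translate[OF f] polyfun_translate[OF g], of b b] fg that
    by (auto simp: sumset_def)
  show "vanishes_on f (sumset A B) \<or> vanishes_on g (sumset A B)"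
  proof (rule ccontr)
    assume "\<not> ?thesis"
    then obtain a b a' b' where ab: "a \<in> A" "b \<in> B" "f (a + b) \<noteq> 0"
      "a' \<in> A" "b' \<in> B" "g (a' + b') \<noteq> 0"
      by (auto simp: sumset_def)
    then obtain c where "c \<in> B" "f (a + c) * g (a' + c) \<noteq> 0"
      using irreducible_set_mult[OF B polyfun_translate'[OF f] polyfun_translate'[OF g], of a a']
      by auto
    then show False using *[of c] ab by auto
  qed
qed

text \<open>Any two points lie on a line, and there a product of two univariate polynomials is zero
  only if a factor is.\<close>

lemma irreducible_set_UNIV: "irreducible_set (UNIV :: ('a::{idom, ring_char_0} ^ 'n) set)"
  unfolding irreducible_set_def
proof (intro conjI allI impI)
  fix f g :: "'a ^ 'n \<Rightarrow> 'a"
  assume f: "polyfun f" and g: "polyfun g" and fg: "vanishes_on (\<lambda>z. f z * g z) UNIV"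
  have "f v = 0 \<or> g u = 0" for u v
  proof -
    have "line_poly f v (u - v) * line_poly g v (u - v) = 0"
      by (subst poly_eq_poly_eq_iff[symmetric]) (use f g fg in \<open>auto simp: poly_line_poly\<close>)
    then have "poly (line_poly f v (u - v)) 0 = 0 \<or> poly (line_poly g v (u - v)) 1 = 0"
      by auto
    then show ?thesis using f g by (simp add: poly_line_poly)
  qed
  then show "vanishes_on f UNIV \<or> vanishes_on g UNIV" by blast
qed simp

lemma irreducible_set_singleton: "irreducible_set {0 :: 'a::idom ^ 'n}"
  by (auto simp: irreducible_set_def)

lemma irreducible_set_line: "irreducible_set (range (\<lambda>t. t *s (w :: 'a::{idom, ring_char_0} ^ 'n)))"
proof -
  \<comment> \<open>The image lemma needs a source in a coordinate space, so the parameter is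
    encoded as one arbitrary coordinate of a vector.\<close>
  have "irreducible_set ((\<lambda>x::'a^'n. (x $ undefined) *s w) ` UNIV)"
    by (rule irreducible_set_image[OF irreducible_set_UNIV]) (auto intro: polyfun_intros)
  moreover have "(\<lambda>x::'a^'n. (x $ undefined) *s w) ` UNIV = range (\<lambda>t. t *s w)"
  proof (intro equalityI subsetI; clarsimp)
    fix t show "t *s w \<in> range (\<lambda>x::'a^'n. (x $ undefined) *s w)"
      by (rule range_eqI[of _ _ "\<chi> i. t"]) simp
  qed
  ultimately show ?thesis by simp
qed

section \<open>Expansion and pseudo-division along a direction\<close>

text \<open>\<open>lam\<close> is a coordinate along \<open>w\<close>: the point
  \<open>v - lam v *s w\<close> is the same for all \<open>v\<close> on a line in direction
  \<open>w\<close>. Hence polynomial functions become polynomials in \<open>lam\<close> with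
  coefficients constant on these lines.\<close>

locale direction =
  fixes w :: "'a::field_char_0 ^ 'n" and lam :: "'a ^ 'n \<Rightarrow> 'a"
  assumes polyfun_lam: "polyfun lam" and lam_add: "lam (v + t *s w) = lam v + t"
begin

definition winv :: "('a ^ 'n \<Rightarrow> 'a) \<Rightarrow> bool" where
  "winv f \<longleftrightarrow> (\<forall>v t. f (v + t *s w) = f v)"

definition coefs :: "(nat \<Rightarrow> 'a ^ 'n \<Rightarrow> 'a) \<Rightarrow> bool" where
  "coefs c \<longleftrightarrow> (\<forall>k. polyfun (c k) \<and> winv (c k))"

text \<open>The bound \<open>n\<close> counts terms, so the degree in \<open>lam\<close> is below
  \<open>n\<close>; a polynomial of degree \<open>m\<close> appears as
  \<open>expn p (Suc m)\<close>.\<close>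

definition expn :: "(nat \<Rightarrow> 'a ^ 'n \<Rightarrow> 'a) \<Rightarrow> nat \<Rightarrow> 'a ^ 'n \<Rightarrow> 'a" where
  "expn c n v = (\<Sum>k<n. c k v * lam v ^ k)"

lemma polyfun_expn: "coefs c \<Longrightarrow> polyfun (expn c n)"
  unfolding expn_def[abs_def] coefs_def by (auto intro!: polyfun_intros polyfun_lam)

lemma coefsD: "coefs c \<Longrightarrow> polyfun (c k)" "coefs c \<Longrightarrow> c k (v + t *s w) = c k v"
  by (auto simp: coefs_def winv_def)

lemma expn_Suc: "expn c (Suc n) v = expn c n v + c n v * lam v ^ n"
  by (simp add: expn_def)

text \<open>Restrict \<open>f\<close> to the line through \<open>v\<close>, based at the point where
  \<open>lam\<close> is 0. All points of the line share this base point, so the coefficients are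
  invariant. They are kept explicit because the top one is constant for a function monic along
  \<open>w\<close>.\<close>

lemma expansion_degree:
  assumes f: "polyfun f" and D: "\<And>v. degree (line_poly f v w) \<le> D"
  obtains c where "coefs c" "\<And>v. f v = expn c (Suc D) v"
    "\<And>k v. c k v = coeff (line_poly f (v - lam v *s w) w) k"
proof -
  define c where "c k v = coeff (line_poly f (v - lam v *s w) w) k" for k v
  have "polyfun (c k)" for k
    unfolding c_def[abs_def]
    by (rule polyfun_coeff_line_poly[OF f]) (auto intro!: polyfun_intros polyfun_lam)
  moreover have "winv (c k)" for k
    by (auto simp: winv_def c_def lam_add vec.scale_left_distrib)
  ultimately have "coefs c" by (auto simp: coefs_def)
  moreover have "f v = expn c (Suc D) v" for v
  proof -
    have "f v = poly (line_poly f (v - lam v *s w) w) (lam v)"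
      using f by (simp add: poly_line_poly)
    also have "\<dots> = expn c (Suc D) v"
      by (subst poly_eq_sum_bound[OF D]) (simp add: c_def expn_def lessThan_Suc_atMost)
    finally show ?thesis .
  qed
  ultimately show ?thesis using that[of c] by (simp add: c_def)
qed

lemma expansion:
  assumes f: "polyfun f"
  obtains n c where "coefs c" "\<And>v. f v = expn c n v"
proof -
  obtain D where D: "\<And>v w. degree (line_poly f v w) \<le> D"
    using degree_line_poly_bounded[OF f] by blast
  show ?thesis
    by (rule expansion_degree[OF f, of D]) (use D that in blast)+
qed

text \<open>Each round multiplies by the leading coefficient \<open>p m\<close> and cancels the top
  term of \<open>g\<close>; as \<open>p m\<close> need not be invertible, a power of it stays on the
  left. The last clause records the top coefficient of the quotient, which later contradicts
  minimality when the quotient vanishes on a set.\<close>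

lemma pseudo_division:
  assumes p: "coefs p" and "coefs g"
  shows "\<exists>K q r. coefs q \<and> coefs r \<and>
    (\<forall>v. p m v ^ K * expn g n v = expn q (n - m) v * expn p (Suc m) v + expn r m v) \<and>
    (m < n \<longrightarrow> (\<exists>K'. \<forall>v. q (n - Suc m) v = p m v ^ K' * g (n - 1) v))"
  using assms(2)
proof (induction n arbitrary: g)
  case 0
  have "coefs (\<lambda>_ _. 0)" by (auto simp: coefs_def winv_def intro: polyfun_intros)
  then show ?case
    by (intro exI[of _ 0] exI[of _ "\<lambda>_ _. 0"]) (auto simp: expn_def)
next
  case (Suc n)
  show ?case
  proof (cases "Suc n \<le> m")
    case True
    define r where "r k = (if k < Suc n then g k else (\<lambda>_. 0))" for k
    have "expn g (Suc n) v = expn r m v" for v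
      unfolding expn_def
      by (rule sum.mono_neutral_cong_left) (use True in \<open>auto simp: r_def\<close>)
    moreover have "coefs r" "coefs (\<lambda>_ _. 0)"
      using Suc.prems by (auto simp: coefs_def winv_def r_def intro: polyfun_intros)
    ultimately show ?thesis using True
      by (intro exI[of _ 0] exI[of _ "\<lambda>_ _. 0"] exI[of _ r]) (auto simp: expn_def)
  next
    case False
    then have mn: "m \<le> n" by simp
    define g' where "g' k v =
      p m v * g k v - (if k \<ge> n - m then g n v * p (k - (n - m)) v else 0)" for k v
    have g': "coefs g'"
      using Suc.prems p
      by (auto simp: coefs_def winv_def g'_def[abs_def]
          intro!: polyfun_diff polyfun_if polyfun.intros)
    have step: "expn g' n v = p m v * expn g (Suc n) v
        - g n v * lam v ^ (n - m) * expn p (Suc m) v" for v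
    proof -
      have "expn g' n v = p m v * expn g n v
          - (\<Sum>k<n. if k \<ge> n - m then g n v * p (k - (n - m)) v * lam v ^ k else 0)"
        unfolding expn_def g'_def
        by (auto simp: sum_distrib_left sum_subtractf[symmetric] algebra_simps intro!: sum.cong)
      also have "(\<Sum>k<n. if k \<ge> n - m then g n v * p (k - (n - m)) v * lam v ^ k else 0)
          = (\<Sum>k\<in>{n-m..<n}. g n v * p (k - (n - m)) v * lam v ^ k)"
        by (rule sum.mono_neutral_cong_right) auto
      also have "\<dots> = (\<Sum>k<m. g n v * p k v * lam v ^ (k + (n - m)))"
        by (rule sum.reindex_bij_witness[of _ "\<lambda>k. k + (n - m)" "\<lambda>k. k - (n - m)"]) (use mn in auto)
      also have "\<dots> = g n v * lam v ^ (n - m) * expn p m v"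
        by (simp add: expn_def sum_distrib_left power_add mult_ac)
      finally show ?thesis
        using mn by (simp add: expn_Suc algebra_simps flip: power_add)
    qed
    obtain K q r where IH: "coefs q" "coefs r"
      "\<And>v. p m v ^ K * expn g' n v = expn q (n - m) v * expn p (Suc m) v + expn r m v"
      using Suc.IH[OF g'] by blast
    define q' where "q' k v = (if k = n - m then p m v ^ K * g n v else q k v)" for k v
    have q': "coefs q'"
      using IH(1) p Suc.prems
      by (auto simp: coefs_def winv_def q'_def[abs_def]
          intro!: polyfun_if polyfun.mult polyfun_power)
    have "expn q' (n - m) v = expn q (n - m) v" for v
      by (auto simp: expn_def q'_def)
    then have q'e: "expn q' (Suc n - m) v = expn q (n - m) v + p m v ^ K * g n v * lam v ^ (n - m)" for v
      using mn by (simp add: Suc_diff_le expn_Suc) (simp add: q'_def)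
    have "p m v ^ Suc K * expn g (Suc n) v
        = expn q' (Suc n - m) v * expn p (Suc m) v + expn r m v" for v
    proof -
      have "p m v ^ Suc K * expn g (Suc n) v
          = p m v ^ K * expn g' n v + p m v ^ K * g n v * lam v ^ (n - m) * expn p (Suc m) v"
        by (simp add: step algebra_simps)
      also have "\<dots> = expn q' (Suc n - m) v * expn p (Suc m) v + expn r m v"
        unfolding q'e IH(3) by (simp add: algebra_simps)
      finally show ?thesis .
    qed
    moreover have "q' (Suc n - Suc m) v = p m v ^ K * g (Suc n - 1) v" for v
      by (simp add: q'_def)
    ultimately show ?thesis using q' IH(2) by blast
  qed
qed

end

lemma direction_exists:
  assumes "w \<noteq> (0 :: 'a::field_char_0 ^ 'n)"
  obtains lam where "direction w lam" "lam 0 = 0"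
proof -
  obtain i where "w $ i \<noteq> 0" using assms by (auto simp: vec_eq_iff)
  moreover have "polyfun (\<lambda>v. v $ i * inverse (w $ i))"
    by (intro polyfun_intros)
  ultimately have "direction w (\<lambda>v. v $ i * inverse (w $ i))"
    by unfold_locales (auto simp: field_simps)
  then show ?thesis using that by fastforce
qed


section \<open>Equations of minimal degree along a direction\<close>

text \<open>Membership in the ideal generated by \<open>b\<close> and the equations of
  \<open>Z\<close>. For \<open>b = 0\<close> it is the ideal of \<open>Z\<close>, so one lemma on
  remainders serves both cases.\<close>

definition mod_ideal :: "('a::comm_ring_1 ^ 'n) set \<Rightarrow> ('a ^ 'n \<Rightarrow> 'a) \<Rightarrow> ('a ^ 'n \<Rightarrow> 'a) \<Rightarrow> bool" where
  "mod_ideal Z b f \<longleftrightarrow> (\<exists>u. polyfun u \<and> vanishes_on (\<lambda>v. f v - u v * b v) Z)"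

lemma mod_ideal_zero: "mod_ideal Z (\<lambda>_. 0) f \<longleftrightarrow> vanishes_on f Z"
  by (auto simp: mod_ideal_def intro: polyfun_intros)

context direction
begin

lemma top_coefficient:
  assumes "\<not> (\<forall>k<n. vanishes_on (c k) Z)"
  shows "\<exists>m<n. \<not> vanishes_on (c m) Z \<and> (\<forall>z\<in>Z. expn c n z = expn c (Suc m) z)"
  using assms
proof (induction n)
  case (Suc n)
  show ?case
  proof (cases "vanishes_on (c n) Z")
    case True
    then have "\<not> (\<forall>k<n. vanishes_on (c k) Z)" using Suc.prems less_Suc_eq by auto
    then obtain m where "m < n" "\<not> vanishes_on (c m) Z" "\<forall>z\<in>Z. expn c n z = expn c (Suc m) z"
      using Suc.IH by blast
    then show ?thesis using True by (intro exI[of _ m]) (auto simp: expn_Suc)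
  qed auto
qed simp

text \<open>If some coefficient survived on \<open>Z\<close>, the topmost surviving one would be the
  leading coefficient of an element of degree below the minimum.\<close>

lemma remainder_vanishes:
  assumes min: "\<forall>k<e. \<forall>s. coefs s \<longrightarrow> mod_ideal Z b (expn s (Suc k)) \<longrightarrow> vanishes_on (s k) Z"
    and r: "coefs r" "mod_ideal Z b (expn r e)" and k: "k < e"
  shows "vanishes_on (r k) Z"
proof (rule ccontr)
  assume "\<not> ?thesis"
  then have "\<not> (\<forall>k<e. vanishes_on (r k) Z)" using k by blast
  from top_coefficient[OF this] obtain m where m: "m < e" "\<not> vanishes_on (r m) Z"
    "\<forall>z\<in>Z. expn r e z = expn r (Suc m) z" by blast
  then have "mod_ideal Z b (expn r (Suc m))"
    using r(2) by (simp add: mod_ideal_def)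
  then show False using min m(1,2) r(1) by blast
qed

lemma expn_vanishes: "(\<And>k. k < n \<Longrightarrow> c k v = 0) \<Longrightarrow> expn c n v = 0"
  by (simp add: expn_def)

text \<open>This is the minimal polynomial of \<open>lam\<close> over the invariant functions modulo
  the ideal of \<open>Z\<close>, with denominators cleared.\<close>

definition minimal_equation :: "('a ^ 'n) set \<Rightarrow> (nat \<Rightarrow> 'a ^ 'n \<Rightarrow> 'a) \<Rightarrow> nat \<Rightarrow> bool" where
  "minimal_equation Z p m \<longleftrightarrow> coefs p \<and> \<not> vanishes_on (p m) Z \<and> vanishes_on (expn p (Suc m)) Z \<and>
    (\<forall>k<m. \<forall>s. coefs s \<longrightarrow> vanishes_on (expn s (Suc k)) Z \<longrightarrow> vanishes_on (s k) Z)"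

lemma minimal_equation_pos: "minimal_equation Z p m \<Longrightarrow> m > 0"
  by (rule ccontr) (auto simp: minimal_equation_def expn_def)

text \<open>Invariant coefficients that vanish at \<open>z\<close> vanish along the whole line
  through \<open>z\<close>. As \<open>f\<close> is nonzero somewhere on that line, one of its
  coefficients survives on \<open>Z\<close>.\<close>

lemma minimal_equation_exists:
  assumes p: "polyfun f" "vanishes_on f Z" and z: "z \<in> Z" "f (z + t *s w) \<noteq> 0"
  obtains m p where "minimal_equation Z p m"
proof -
  define A where "A = {m. \<exists>c. coefs c \<and> \<not> vanishes_on (c m) Z \<and> vanishes_on (expn c (Suc m)) Z}"
  obtain n c where c: "coefs c" "\<And>v. f v = expn c n v"
    using expansion[OF p(1)] by blast
  have "\<not> (\<forall>k<n. vanishes_on (c k) Z)"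
  proof
    assume "\<forall>k<n. vanishes_on (c k) Z"
    then have "expn c n (z + t *s w) = 0"
      by (intro expn_vanishes) (use z(1) coefsD(2)[OF c(1)] in auto)
    then show False using z c(2) by simp
  qed
  from top_coefficient[OF this] obtain m0 where
    "\<not> vanishes_on (c m0) Z" "\<forall>z\<in>Z. expn c n z = expn c (Suc m0) z" by blast
  then have "m0 \<in> A" unfolding A_def using c p(2) by auto
  then have A: "(LEAST m. m \<in> A) \<in> A" by (rule LeastI)
  define m where "m = (LEAST m. m \<in> A)"
  from A obtain p where pm: "coefs p" "\<not> vanishes_on (p m) Z" "vanishes_on (expn p (Suc m)) Z"
    unfolding m_def[symmetric] by (auto simp: A_def)
  have "vanishes_on (s k) Z" if "k < m" "coefs s" "vanishes_on (expn s (Suc k)) Z" for k s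
  proof -
    have "k \<notin> A" using not_less_Least[of k "\<lambda>m. m \<in> A"] that(1) by (simp add: m_def)
    then show ?thesis using that(2,3) by (auto simp: A_def)
  qed
  with pm have "minimal_equation Z p m" unfolding minimal_equation_def by blast
  then show ?thesis by (rule that)
qed

text \<open>Makes the ideal of \<open>Z\<close> explicit up to a power of the leading coefficient:
  multiples of the minimal equation, plus combinations of equations that are invariant.\<close>

lemma minimal_equation_division:
  assumes p: "minimal_equation Z p m"
    and g: "polyfun g" "vanishes_on g Z"
  obtains K q r where "polyfun q" "coefs r" "\<forall>k<m. vanishes_on (r k) Z"
    "\<forall>v. p m v ^ K * g v = q v * expn p (Suc m) v + expn r m v"
proof -
  obtain n c where c: "coefs c" "\<And>v. g v = expn c n v"
    using expansion[OF g(1)] by blast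
  obtain K q r where q: "coefs q" "coefs r"
    "\<And>v. p m v ^ K * expn c n v = expn q (n - m) v * expn p (Suc m) v + expn r m v"
    using pseudo_division[OF _ c(1), of p m n] p unfolding minimal_equation_def by blast
  have "vanishes_on (expn r m) Z"
  proof
    fix z assume "z \<in> Z"
    then show "expn r m z = 0" using q(3)[of z] c(2)[of z] g(2) p by (simp add: minimal_equation_def)
  qed
  then have "vanishes_on (r k) Z" if "k < m" for k
    using remainder_vanishes[where b = "\<lambda>_. 0", unfolded mod_ideal_zero, OF _ q(2) _ that] p
    unfolding minimal_equation_def by blast
  then show ?thesis
    using polyfun_expn[OF q(1)] q(2,3) c(2)
    by (intro that[where K = K and q = "expn q (n - m)" and r = r]) simp_all
qed

text \<open>
  Modulo the ideal of \<open>Z\<close> the given direction is algebraic over the invariant functions, so the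
  nonzero element \<open>b\<close> divides a nonzero invariant function.
\<close>

lemma invariant_multiple:
  assumes Z: "irreducible_set Z" and f: "polyfun f" "vanishes_on f Z"
    and z: "z \<in> Z" "f (z + t *s w) \<noteq> 0" and b: "polyfun b" "\<not> vanishes_on b Z"
  obtains h where "polyfun h" "winv h" "\<not> vanishes_on h Z"
    "\<forall>z\<in>zariski_closure Z. h z \<noteq> 0 \<longrightarrow> b z \<noteq> 0"
proof -
  obtain m p where mp: "minimal_equation Z p m"
    by (rule minimal_equation_exists[OF f z])
  have "m > 0" by (rule minimal_equation_pos[OF mp])
  have p: "coefs p" "\<not> vanishes_on (p m) Z" "vanishes_on (expn p (Suc m)) Z"
    using mp by (auto simp: minimal_equation_def)
  \<comment> \<open>The possible degrees of elements of the ideal generated by \<open>b\<close> and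
    the equations of \<open>Z\<close>, with leading coefficient surviving on \<open>Z\<close>.
    Degree 0 is the goal, since such an element is an invariant function.\<close>
  define B where "B = {e. \<exists>s. coefs s \<and> \<not> vanishes_on (s e) Z \<and> mod_ideal Z b (expn s (Suc e))}"
  have "mod_ideal Z b (expn p (Suc m))"
    unfolding mod_ideal_def by (rule exI[of _ "\<lambda>_. 0"]) (use p(3) in \<open>auto intro: polyfun_intros\<close>)
  then have mB: "m \<in> B" using p by (auto simp: B_def)
  define e where "e = (LEAST e. e \<in> B)"
  have "e \<in> B" "e \<le> m" unfolding e_def using mB by (auto intro: LeastI Least_le)
  then obtain s where s: "coefs s" "\<not> vanishes_on (s e) Z" "mod_ideal Z b (expn s (Suc e))"
    by (auto simp: B_def)
  have emin: "\<forall>k<e. \<forall>c. coefs c \<longrightarrow> mod_ideal Z b (expn c (Suc k)) \<longrightarrow> vanishes_on (c k) Z"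
  proof (intro allI impI)
    fix k c assume c: "k < e" "coefs c" "mod_ideal Z b (expn c (Suc k))"
    have "k \<notin> B" using not_less_Least[of k "\<lambda>m. m \<in> B"] c(1) by (simp add: e_def)
    then show "vanishes_on (c k) Z" using c by (auto simp: B_def)
  qed
  from s(3) obtain u where u: "polyfun u" "vanishes_on (\<lambda>v. expn s (Suc e) v - u v * b v) Z"
    by (auto simp: mod_ideal_def)
  have div: "\<exists>K q. coefs q \<and> (\<forall>z\<in>Z. s e z ^ K * expn c n z = expn q (n - e) z * expn s (Suc e) z)
      \<and> (e < n \<longrightarrow> (\<exists>K'. \<forall>v. q (n - Suc e) v = s e v ^ K' * c (n - 1) v))"
    if c: "coefs c" "mod_ideal Z b (expn c n)" for c n
  proof -
    from pseudo_division[OF s(1) c(1), of e n]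
    obtain K q r where q: "coefs q" "coefs r"
      "\<And>v. s e v ^ K * expn c n v = expn q (n - e) v * expn s (Suc e) v + expn r e v"
      "e < n \<longrightarrow> (\<exists>K'. \<forall>v. q (n - Suc e) v = s e v ^ K' * c (n - 1) v)"
      by blast
    from c(2) obtain u' where u': "polyfun u'" "vanishes_on (\<lambda>v. expn c n v - u' v * b v) Z"
      by (auto simp: mod_ideal_def)
    have "mod_ideal Z b (expn r e)"
      unfolding mod_ideal_def
    proof (intro exI[of _ "\<lambda>v. s e v ^ K * u' v - expn q (n - e) v * u v"] conjI ballI)
      show "polyfun (\<lambda>v. s e v ^ K * u' v - expn q (n - e) v * u v)"
        using u u' coefsD(1)[OF s(1)] polyfun_expn[OF q(1)] by (intro polyfun_intros)
      fix z assume "z \<in> Z"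
      then have 1: "expn s (Suc e) z = u z * b z" "expn c n z = u' z * b z"
        using u u' by auto
      have "expn r e z = s e z ^ K * expn c n z - expn q (n - e) z * expn s (Suc e) z"
        using q(3)[of z] by simp
      then show "expn r e z - (s e z ^ K * u' z - expn q (n - e) z * u z) * b z = 0"
        unfolding 1 by (simp add: algebra_simps)
    qed
    then have "vanishes_on (r k) Z" if "k < e" for k
      using remainder_vanishes[OF emin q(2) _ that] by blast
    then have "expn r e z = 0" if "z \<in> Z" for z
      using that by (intro expn_vanishes) auto
    then show ?thesis using q by (intro exI[of _ K] exI[of _ q]) auto
  qed
  \<comment> \<open>For positive \<open>e\<close> there are two cases. If the minimal element
    vanishes on \<open>Z\<close>, dividing \<open>b\<close> by it shows that \<open>b\<close>
    vanishes on \<open>Z\<close>. Otherwise divide the minimal equation by it: the quotient must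
    vanish on \<open>Z\<close>, but it has degree \<open>m - e < m\<close> and a surviving leading
    coefficient.\<close>
  have "e = 0"
  proof (rule ccontr)
    assume "e \<noteq> 0"
    have pols: "polyfun (s e)" "polyfun (expn s (Suc e))"
      using s(1) by (auto intro: coefsD polyfun_expn)
    show False
    proof (cases "vanishes_on (expn s (Suc e)) Z")
      case True
      obtain n c where c: "coefs c" "\<And>v. b v = expn c n v"
        using expansion[OF b(1)] by blast
      have "mod_ideal Z b (expn c n)"
        unfolding mod_ideal_def
        by (rule exI[of _ "\<lambda>_. 1"]) (auto intro: polyfun_intros simp flip: c(2))
      from div[OF c(1) this] obtain K q where
        "\<forall>z\<in>Z. s e z ^ K * b z = expn q (n - e) z * expn s (Suc e) z"
        unfolding c(2)[symmetric] by blast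
      with True have "vanishes_on (\<lambda>z. s e z ^ K * b z) Z" by simp
      from irreducible_set_power[OF Z pols(1) this b(1) s(2)] b(2) show False by blast
    next
      case False
      have "mod_ideal Z b (expn p (Suc m))" by fact
      from div[OF p(1) this] obtain K K' q where q: "coefs q"
        "\<forall>z\<in>Z. s e z ^ K * expn p (Suc m) z = expn q (Suc m - e) z * expn s (Suc e) z"
        "\<And>v. q (m - e) v = s e v ^ K' * p m v"
        using \<open>e \<le> m\<close> by auto
      then have "vanishes_on (\<lambda>z. expn q (Suc m - e) z * expn s (Suc e) z) Z"
        using p(3) by simp
      from irreducible_setD[OF Z polyfun_expn[OF q(1)] pols(2) this] False
      have "vanishes_on (expn q (Suc (m - e))) Z"
        using \<open>e \<le> m\<close> by (simp add: Suc_diff_le)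
      moreover have "m - e < m" using \<open>e \<noteq> 0\<close> \<open>m > 0\<close> by simp
      ultimately have "vanishes_on (q (m - e)) Z" using mp q(1) unfolding minimal_equation_def by blast
      then have "vanishes_on (\<lambda>z. s e z ^ K' * p m z) Z" using q(3) by simp
      from irreducible_set_power[OF Z pols(1) this _ s(2)] p(1,2) show False
        by (auto intro: coefsD)
    qed
  qed
  show ?thesis
  proof (rule that[of "s 0"])
    show "polyfun (s 0)" "winv (s 0)" using s(1) by (auto simp: coefs_def)
    show "\<not> vanishes_on (s 0) Z" using s(2) \<open>e = 0\<close> by simp
    show "\<forall>z\<in>zariski_closure Z. s 0 z \<noteq> 0 \<longrightarrow> b z \<noteq> 0"
    proof (intro ballI impI)
      fix z assume z: "z \<in> zariski_closure Z" "s 0 z \<noteq> 0"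
      have "vanishes_on (\<lambda>v. s 0 v - u v * b v) Z"
        using u(2) \<open>e = 0\<close> by (simp add: expn_def)
      then have "s 0 z - u z * b z = 0"
        by (rule zariski_closureD[OF z(1), rotated])
          (intro polyfun_diff polyfun.mult coefsD(1)[OF s(1)] u b)
      then show "b z \<noteq> 0" using z(2) by auto
    qed
  qed
qed

end


section \<open>Images of irreducible sets under addition\<close>

abbreviation line_through :: "'a::field ^ 'n \<Rightarrow> ('a ^ 'n) set" where
  "line_through w \<equiv> range (\<lambda>t. t *s w)"

text \<open>The extension theorem of elimination theory. Where the leading coefficient of the
  minimal equation is nonzero, a root of that equation leads from \<open>y\<close> to a point of the
  closure of \<open>Z\<close>; an invariant multiple of \<open>b\<close> keeps \<open>b\<close>
  nonzero at this point.\<close>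

lemma projection_step:
  fixes Z :: "('a::{alg_closed_field, field_char_0} ^ 'n) set"
  assumes Z: "irreducible_set Z" and b: "polyfun b" "\<not> vanishes_on b Z"
  obtains a where "polyfun a" "\<not> vanishes_on a Z"
    "\<And>y. y \<in> zariski_closure (sumset Z (line_through w)) \<Longrightarrow> a y \<noteq> 0 \<Longrightarrow>
      \<exists>t. y + t *s w \<in> zariski_closure Z \<and> b (y + t *s w) \<noteq> 0"
proof (cases "\<exists>f z t. polyfun f \<and> vanishes_on f Z \<and> z \<in> Z \<and> f (z + t *s w) \<noteq> 0")
  \<comment> \<open>Every equation of \<open>Z\<close> vanishes on the lines through
    \<open>Z\<close> too, so both closures agree and \<open>t = 0\<close> works.\<close>
  case False
  show ?thesis
  proof (rule that[OF b])
    fix y assume y: "y \<in> zariski_closure (sumset Z (line_through w))" "b y \<noteq> 0"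
    have "y \<in> zariski_closure Z"
      unfolding zariski_closure_def
    proof (intro CollectI allI impI)
      fix f assume f: "polyfun f" "vanishes_on f Z"
      show "f y = 0"
        by (rule zariski_closureD[OF y(1) f(1)]) (use f False in \<open>auto simp: sumset_def\<close>)
    qed
    then show "\<exists>t. y + t *s w \<in> zariski_closure Z \<and> b (y + t *s w) \<noteq> 0"
      using y by (intro exI[of _ 0]) simp
  qed
next
  case True
  then obtain f z t where f: "polyfun f" "vanishes_on f Z" and z: "z \<in> Z" "f (z + t *s w) \<noteq> 0"
    by blast
  then have "w \<noteq> 0" by auto
  then obtain lam where "direction w lam" using direction_exists by blast
  then interpret direction w lam .
  obtain h where h: "polyfun h" "winv h" "\<not> vanishes_on h Z"
    "\<forall>z\<in>zariski_closure Z. h z \<noteq> 0 \<longrightarrow> b z \<noteq> 0"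
    by (rule invariant_multiple[OF Z f z b])
  obtain m p where mp: "minimal_equation Z p m"
    by (rule minimal_equation_exists[OF f z])
  have "m > 0" by (rule minimal_equation_pos[OF mp])
  have p: "coefs p" "\<not> vanishes_on (p m) Z" "vanishes_on (expn p (Suc m)) Z"
    using mp by (auto simp: minimal_equation_def)
  show ?thesis
  proof (rule that[of "\<lambda>v. h v * p m v"])
    show "polyfun (\<lambda>v. h v * p m v)"
      using h coefsD(1)[OF p(1)] by (intro polyfun_intros)
    show "\<not> vanishes_on (\<lambda>v. h v * p m v) Z"
      using irreducible_set_mult[OF Z h(1) coefsD(1)[OF p(1)]] h(3) p(2) by blast
    fix y assume y: "y \<in> zariski_closure (sumset Z (line_through w))" "h y * p m y \<noteq> 0"
    \<comment> \<open>The minimal equation on the line through \<open>y\<close>, with the value of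
      \<open>lam\<close> as unknown.\<close>
    define P where "P = (\<Sum>k\<le>m. monom (p k y) k)"
    have "coeff P m \<noteq> 0" using y by (simp add: P_def coeff_sum coeff_monom if_distrib sum.delta)
    then have "degree P > 0" using le_degree[of P m] \<open>m > 0\<close> by simp
    then obtain x where x: "poly P x = 0" using alg_closed_imp_poly_has_root by blast
    define y' where "y' = y + (x - lam y) *s w"
    have lam_y': "lam y' = x" unfolding y'_def lam_add by simp
    have inv: "g y' = g y" if "winv g" for g using that unfolding winv_def y'_def by blast
    have "expn p (Suc m) y' = poly P x"
      unfolding expn_def lam_y' P_def poly_sum poly_monom lessThan_Suc_atMost
      by (intro sum.cong refl) (use p(1) in \<open>auto simp: coefs_def inv\<close>)
    then have py': "expn p (Suc m) y' = 0" using x by simp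
    have "y' \<in> zariski_closure Z"
      unfolding zariski_closure_def
    proof (intro CollectI allI impI)
      fix g assume g: "polyfun g" "vanishes_on g Z"
      obtain K q r where q: "polyfun q" "coefs r" "\<forall>k<m. vanishes_on (r k) Z"
        "\<forall>v. p m v ^ K * g v = q v * expn p (Suc m) v + expn r m v"
        by (rule minimal_equation_division[OF mp g])
      \<comment> \<open>Being constant along \<open>w\<close>, these coefficients vanish on all
        lines through \<open>Z\<close>, hence at \<open>y\<close> in the closure.\<close>
      have "r k y = 0" if "k < m" for k
        by (rule zariski_closureD[OF y(1) coefsD(1)[OF q(2)]])
          (use q(3) that coefsD(2)[OF q(2)] in \<open>auto simp: sumset_def\<close>)
      then have "expn r m y' = 0"
        by (intro expn_vanishes) (use q(2) in \<open>auto simp: coefs_def inv\<close>)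
      then have "p m y ^ K * g y' = 0"
        using q(4)[rule_format, of y'] py' p(1) by (simp add: inv coefs_def)
      then show "g y' = 0" using y by simp
    qed
    moreover have "h y' \<noteq> 0" using y h(2) by (simp add: inv)
    ultimately show "\<exists>t. y + t *s w \<in> zariski_closure Z \<and> b (y + t *s w) \<noteq> 0"
      using h(4) unfolding y'_def by blast
  qed
qed

fun line_sums :: "('a::field ^ 'n) list \<Rightarrow> ('a ^ 'n) set" where
  "line_sums [] = {0}"
| "line_sums (w # ws) = sumset (line_through w) (line_sums ws)"

lemma sumset_assoc: "sumset (sumset A B) C = sumset A (sumset B (C :: 'a::semigroup_add set))"
  by (auto simp: sumset_def) (metis add.assoc)+

lemma sumset_zero_right: "sumset A {0 :: 'a::monoid_add} = A"
  by (auto simp: sumset_def)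

lemma projection:
  fixes Z :: "('a::{alg_closed_field, field_char_0} ^ 'n) set"
  assumes "irreducible_set Z" "polyfun b" "\<not> vanishes_on b Z"
  shows "\<exists>a. polyfun a \<and> \<not> vanishes_on a (sumset Z (line_sums ws)) \<and>
    (\<forall>y \<in> zariski_closure (sumset Z (line_sums ws)). a y \<noteq> 0 \<longrightarrow>
      (\<exists>u\<in>line_sums ws. y + u \<in> zariski_closure Z \<and> b (y + u) \<noteq> 0))"
  using assms
proof (induction ws arbitrary: Z b)
  case Nil
  then show ?case by (intro exI[of _ b]) (simp add: sumset_zero_right)
next
  case (Cons w ws)
  let ?Z = "sumset Z (line_through w)"
  obtain a where a: "polyfun a" "\<not> vanishes_on a Z"
    "\<And>y. y \<in> zariski_closure ?Z \<Longrightarrow> a y \<noteq> 0 \<Longrightarrow>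
      \<exists>t. y + t *s w \<in> zariski_closure Z \<and> b (y + t *s w) \<noteq> 0"
    using projection_step[OF Cons.prems, of w] by metis
  have "Z \<subseteq> ?Z"
  proof
    fix z assume "z \<in> Z"
    then show "z \<in> ?Z" using sumsetI[OF _ rangeI, of z Z "\<lambda>t. t *s w" 0] by simp
  qed
  then have "\<not> vanishes_on a ?Z" using a(2) by blast
  from Cons.IH[OF irreducible_set_sumset[OF Cons.prems(1) irreducible_set_line] a(1) this]
  obtain a' where a': "polyfun a'" "\<not> vanishes_on a' (sumset ?Z (line_sums ws))"
    "\<forall>y \<in> zariski_closure (sumset ?Z (line_sums ws)). a' y \<noteq> 0 \<longrightarrow>
      (\<exists>u\<in>line_sums ws. y + u \<in> zariski_closure ?Z \<and> a (y + u) \<noteq> 0)"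
    by blast
  show ?case
  proof (intro exI[of _ a'] conjI ballI impI)
    show "polyfun a'" by fact
    show "\<not> vanishes_on a' (sumset Z (line_sums (w # ws)))"
      using a'(2) by (simp add: sumset_assoc)
    fix y assume "y \<in> zariski_closure (sumset Z (line_sums (w # ws)))" "a' y \<noteq> 0"
    then obtain u where u: "u \<in> line_sums ws" "y + u \<in> zariski_closure ?Z" "a (y + u) \<noteq> 0"
      using a'(3) by (auto simp: sumset_assoc)
    from a(3)[OF u(2,3)] obtain t where
      "(y + u) + t *s w \<in> zariski_closure Z" "b ((y + u) + t *s w) \<noteq> 0" by blast
    moreover have "t *s w + u \<in> line_sums (w # ws)" using u(1) by (auto intro: sumsetI)
    ultimately show "\<exists>u\<in>line_sums (w # ws). y + u \<in> zariski_closure Z \<and> b (y + u) \<noteq> 0"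
      by (intro bexI[of _ "t *s w + u"]) (simp_all add: add_ac)
  qed
qed

section \<open>Sums of sets contain an open part of their closure\<close>

definition contains_open :: "('a::comm_ring_1 ^ 'n) set \<Rightarrow> bool" where
  "contains_open Z \<longleftrightarrow> (\<exists>g. polyfun g \<and> \<not> vanishes_on g Z \<and>
    (\<forall>v\<in>zariski_closure Z. g v \<noteq> 0 \<longrightarrow> v \<in> Z))"

definition joinv :: "'a ^ 'n \<Rightarrow> 'a ^ 'n \<Rightarrow> 'a ^ ('n + 'n)" where
  "joinv u v = (\<chi> i. case i of Inl j \<Rightarrow> u $ j | Inr j \<Rightarrow> v $ j)"

lemma joinv_nth [simp]: "joinv u v $ Inl j = u $ j" "joinv u v $ Inr j = v $ j"
  by (auto simp: joinv_def)

lemma joinv_eq_iff: "x = joinv u v \<longleftrightarrow> (\<forall>j. x $ Inl j = u $ j) \<and> (\<forall>j. x $ Inr j = v $ j)"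
  by (auto simp: vec_eq_iff) (metis joinv_nth sum.exhaust)

lemma joinv_add: "joinv u v + joinv u' v' = joinv (u + u') (v + v')"
  by (simp add: joinv_eq_iff)

lemma polyfun_joinv:
  assumes "\<And>j. polyfun (\<lambda>x. u x $ j)" "\<And>j. polyfun (\<lambda>x. v x $ j)"
  shows "polyfun (\<lambda>x. joinv (u x) (v x) $ i)"
  by (cases i) (use assms in auto)

theorem contains_open_sumset:
  fixes B C :: "('a::{alg_closed_field, field_char_0} ^ 'n::finite) set"
  assumes B: "irreducible_set B" "contains_open B" and C: "irreducible_set C" "contains_open C"
  shows "contains_open (sumset B C)"
proof -
  obtain gB where gB: "polyfun gB" "\<not> vanishes_on gB B" "\<forall>v\<in>zariski_closure B. gB v \<noteq> 0 \<longrightarrow> v \<in> B"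
    using B(2) by (auto simp: contains_open_def)
  obtain gC where gC: "polyfun gC" "\<not> vanishes_on gC C" "\<forall>v\<in>zariski_closure C. gC v \<noteq> 0 \<longrightarrow> v \<in> C"
    using C(2) by (auto simp: contains_open_def)
  \<comment> \<open>The pairs (b + c, c): the graph of addition in sheared coordinates. Forgetting
    the second component projects it onto the set of sums.\<close>
  define Z where "Z = sumset ((\<lambda>b. joinv b 0) ` B) ((\<lambda>c. joinv c c) ` C)"
  have Z: "irreducible_set Z"
    unfolding Z_def
    by (intro irreducible_set_sumset irreducible_set_image B C)
      (auto intro!: polyfun_joinv polyfun_intros)
  define snd' where "snd' x = (\<chi> j. x $ Inr j)" for x :: "'a ^ ('n + 'n)"
  define sub where "sub x = (\<chi> j. x $ Inl j - x $ Inr j)" for x :: "'a ^ ('n + 'n)"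
  have snd': "snd' (joinv u v) = v" and sub: "sub (joinv u v) = u - v" for u v
    by (simp_all add: snd'_def sub_def vec_eq_iff)
  have pol_snd: "polyfun (\<lambda>x. f (snd' x))" and pol_sub: "polyfun (\<lambda>x. f (sub x))"
    if "polyfun f" for f
    using that by (auto intro!: polyfun_compose[OF that] polyfun_intros simp: snd'_def sub_def)
  have Zcl: "sub x \<in> zariski_closure B" "snd' x \<in> zariski_closure C"
    if "x \<in> zariski_closure Z" for x
  proof -
    have "f (sub x) = 0" if "polyfun f" "vanishes_on f B" for f
      by (rule zariski_closureD[OF \<open>x \<in> zariski_closure Z\<close> pol_sub])
        (use that in \<open>auto simp: Z_def sumset_def joinv_add sub\<close>)
    then show "sub x \<in> zariski_closure B" by (simp add: zariski_closure_def)
    have "f (snd' x) = 0" if "polyfun f" "vanishes_on f C" for f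
      by (rule zariski_closureD[OF \<open>x \<in> zariski_closure Z\<close> pol_snd])
        (use that in \<open>auto simp: Z_def sumset_def joinv_add snd'\<close>)
    then show "snd' x \<in> zariski_closure C" by (simp add: zariski_closure_def)
  qed
  define b where "b x = gB (sub x) * gC (snd' x)" for x
  have b: "polyfun b" unfolding b_def[abs_def] by (intro polyfun_intros pol_sub pol_snd gB gC)
  obtain b0 c0 where bc0: "b0 \<in> B" "gB b0 \<noteq> 0" "c0 \<in> C" "gC c0 \<noteq> 0" using gB gC by blast
  then have "joinv b0 0 + joinv c0 c0 \<in> Z" unfolding Z_def by (intro sumsetI) auto
  moreover have "b (joinv b0 0 + joinv c0 c0) \<noteq> 0"
    using bc0 by (simp add: b_def joinv_add sub snd')
  ultimately have "\<not> vanishes_on b Z" by blast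
  obtain js :: "'n list" where js: "set js = UNIV" "distinct js"
    using finite_distinct_list[of "UNIV :: 'n set"] by auto
  \<comment> \<open>Adding all lines along the axes of the second component amounts to forgetting
    that component.\<close>
  define ws where "ws = map (\<lambda>j. joinv 0 (axis j (1::'a))) js"
  have ws_sub: "\<exists>u. x = joinv 0 u" if "x \<in> line_sums (map (\<lambda>j. joinv 0 (axis j (1::'a))) l)" for x l
    using that
  proof (induction l arbitrary: x)
    case Nil
    then have "x = joinv 0 0" by (simp add: joinv_eq_iff)
    then show ?case by blast
  next
    case (Cons j l)
    then obtain t x' where x: "x = t *s joinv 0 (axis j 1) + x'"
      "x' \<in> line_sums (map (\<lambda>j. joinv 0 (axis j (1::'a))) l)"
      by (auto simp: sumset_def)
    with Cons.IH obtain u where "x' = joinv 0 u" by blast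
    then have "x = joinv 0 (t *s axis j 1 + u)" using x by (simp add: joinv_eq_iff)
    then show ?case by blast
  qed
  have ws_sup: "joinv 0 u \<in> line_sums ws" for u
  proof -
    have "(\<Sum>j\<leftarrow>l. u $ j *s joinv 0 (axis j 1)) \<in> line_sums (map (\<lambda>j. joinv 0 (axis j (1::'a))) l)"
      for l by (induction l) (auto intro!: sumsetI)
    from this[of js] have "(\<Sum>j\<in>UNIV. u $ j *s joinv 0 (axis j 1)) \<in> line_sums ws"
      by (simp add: ws_def sum_list_distinct_conv_sum_set js)
    moreover have "(\<Sum>j\<in>UNIV. u $ j *s joinv 0 (axis j 1)) = joinv 0 u"
      by (simp add: joinv_eq_iff axis_def if_distrib cong: if_cong)
    ultimately show ?thesis by simp
  qed
  obtain a where a: "polyfun a" "\<not> vanishes_on a (sumset Z (line_sums ws))"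
    "\<forall>y \<in> zariski_closure (sumset Z (line_sums ws)). a y \<noteq> 0 \<longrightarrow>
      (\<exists>u\<in>line_sums ws. y + u \<in> zariski_closure Z \<and> b (y + u) \<noteq> 0)"
    using projection[OF Z b \<open>\<not> vanishes_on b Z\<close>] by blast
  from a(2) obtain b1 c1 u where bc1: "b1 \<in> B" "c1 \<in> C" "u \<in> line_sums ws"
    "a (joinv b1 0 + joinv c1 c1 + u) \<noteq> 0"
    by (auto simp: sumset_def Z_def)
  \<comment> \<open>The enlarged set is stable under changes of the second component, which may
    therefore be frozen at a value where \<open>a\<close> is not identically zero.\<close>
  then obtain u1 where u1: "a (joinv (b1 + c1) u1) \<noteq> 0"
    using ws_sub unfolding ws_def by (fastforce simp: joinv_add)
  show ?thesis
    unfolding contains_open_def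
  proof (intro exI[of _ "\<lambda>z. a (joinv z u1)"] conjI ballI impI)
    show "polyfun (\<lambda>z. a (joinv z u1))"
      by (rule polyfun_compose[OF a(1)]) (auto intro!: polyfun_joinv polyfun_intros)
    show "\<not> vanishes_on (\<lambda>z. a (joinv z u1)) (sumset B C)"
      using u1 sumsetI[OF bc1(1,2)] by blast
    fix z assume z: "z \<in> zariski_closure (sumset B C)" "a (joinv z u1) \<noteq> 0"
    have "joinv z u1 \<in> zariski_closure (sumset Z (line_sums ws))"
      unfolding zariski_closure_def
    proof (intro CollectI allI impI)
      fix f assume f: "polyfun f" "vanishes_on f (sumset Z (line_sums ws))"
      show "f (joinv z u1) = 0"
      proof (rule zariski_closureD[OF z(1)])
        show "polyfun (\<lambda>z. f (joinv z u1))"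
          by (rule polyfun_compose[OF f(1)]) (auto intro!: polyfun_joinv polyfun_intros)
        show "vanishes_on (\<lambda>z. f (joinv z u1)) (sumset B C)"
        proof
          fix x assume "x \<in> sumset B C"
          then obtain b c where bc: "b \<in> B" "c \<in> C" "x = b + c" by (auto simp: sumset_def)
          have "joinv x u1 = (joinv b 0 + joinv c c) + joinv 0 (u1 - c)"
            using bc by (simp add: joinv_add)
          also have "\<dots> \<in> sumset Z (line_sums ws)"
            unfolding Z_def by (intro sumsetI ws_sup) (use bc in auto)
          finally show "f (joinv x u1) = 0" using f(2) by blast
        qed
      qed
    qed
    with a(3) z(2) obtain u where u: "u \<in> line_sums ws" "joinv z u1 + u \<in> zariski_closure Z"
      "b (joinv z u1 + u) \<noteq> 0" by blast
    then obtain c where c: "joinv z u1 + u = joinv z c"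
      using ws_sub unfolding ws_def by (fastforce simp: joinv_add)
    have "z - c \<in> B" "c \<in> C"
      using Zcl[OF u(2)] u(3) gB(3) gC(3) unfolding c b_def by (auto simp: snd' sub)
    then have "(z - c) + c \<in> sumset B C" by (rule sumsetI)
    then show "z \<in> sumset B C" by simp
  qed
qed


section \<open>Divisibility of polynomial functions\<close>

lemma poly_poly_eqI:
  fixes A B :: "'a::field_char_0 poly poly"
  assumes "\<And>s t. poly (poly A [:t:]) s = poly (poly B [:t:]) s"
  shows "A = B"
proof (rule ccontr)
  assume "A \<noteq> B"
  then have "finite {x. poly (A - B) x = 0}" by (intro poly_roots_finite) simp
  moreover have "poly A [:t:] = poly B [:t:]" for t
    using assms[of t] by (simp add: poly_eq_poly_eq_iff[symmetric] fun_eq_iff)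
  then have "range (\<lambda>t. [:t:]) \<subseteq> {x. poly (A - B) x = 0}" by auto
  ultimately have "finite (range (\<lambda>t::'a. [:t:]))" by (rule rev_finite_subset)
  moreover have "inj (\<lambda>t::'a. [:t:])" by (auto intro: injI)
  ultimately have "finite (UNIV :: 'a set)" by (rule finite_imageD)
  then show False using infinite_UNIV_char_0 by blast
qed

text \<open>Evaluating all coefficients at \<open>x\<close> is multiplicative with values in a
  domain, and it kills exactly the multiples of the given constant polynomial.\<close>

lemma const_poly_dvd_mult:
  fixes p q :: "'a::field poly poly"
  assumes "[:[:-x, 1:]:] dvd q * p"
  shows "[:[:-x, 1:]:] dvd q \<or> [:[:-x, 1:]:] dvd p"
proof -
  define ev where "ev = map_poly (\<lambda>c :: 'a poly. poly c x)"
  have coeff_ev: "coeff (ev P) n = poly (coeff P n) x" for P n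
    by (simp add: ev_def coeff_map_poly)
  have dvd_iff: "[:[:-x, 1:]:] dvd P \<longleftrightarrow> ev P = 0" for P
    by (simp add: const_poly_dvd_iff poly_eq_0_iff_dvd[symmetric] poly_eq_iff coeff_ev)
  have "ev (q * p) = ev q * ev p"
    by (rule poly_eqI) (simp add: coeff_ev coeff_mult poly_sum)
  then show ?thesis using assms by (simp add: dvd_iff)
qed

text \<open>A form of Gauss's lemma. Each root of \<open>c\<close> gives a prime dividing
  \<open>q\<close> or \<open>p\<close>; it is cancelled, and restored on both sides of the
  divisibility if it came from \<open>p\<close>. Once \<open>c\<close> is constant, the constant
  leading coefficient of \<open>f\<close> makes that of \<open>p\<close> a unit.\<close>

lemma lead_coeff_dvd_coeff:
  fixes p q f :: "'a::alg_closed_field poly poly"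
  assumes "smult c f = q * p" "c \<noteq> 0" "lead_coeff f = [:a:]" "a \<noteq> 0"
  shows "lead_coeff p dvd coeff p k"
  using assms(1,2)
proof (induction "degree c" arbitrary: c p q k rule: less_induct)
  case less
  show ?case
  proof (cases "degree c = 0")
    case True
    then obtain c0 where c0: "c = [:c0:]" by (rule degree_eq_zeroE)
    have "lead_coeff (smult c f) = lead_coeff q * lead_coeff p"
      unfolding less.prems(1) by (rule lead_coeff_mult)
    then have "[:c0 * a:] = lead_coeff q * lead_coeff p"
      using less.prems(2) c0 assms(3) by simp
    then have "lead_coeff p dvd [:c0 * a:]" by simp
    moreover have "[:c0 * a:] dvd 1" using c0 less.prems(2) assms(4)
      by (simp add: is_unit_const_poly_iff dvd_field_iff)
    ultimately show ?thesis by (meson dvd_trans one_dvd)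
  next
    case False
    then obtain x where "poly c x = 0" using alg_closed_imp_poly_has_root by blast
    then obtain c' where c': "c = [:-x, 1:] * c'" by (auto simp: poly_eq_0_iff_dvd elim: dvdE)
    have "c' \<noteq> 0" using less.prems c' by auto
    have deg: "degree c' < degree c" using \<open>c' \<noteq> 0\<close> unfolding c' by (subst degree_mult_eq) auto
    let ?x = "[:[:-x, 1:]:]"
    have cf: "smult c f = ?x * smult c' f" by (simp add: c' mult.commute)
    have "?x dvd q * p" unfolding less.prems(1)[symmetric] cf by (rule dvd_triv_left)
    then consider q' where "q = ?x * q'" | p' where "p = ?x * p'"
      using const_poly_dvd_mult unfolding dvd_def by blast
    then show ?thesis
    proof cases
      case 1
      then have "?x * smult c' f = ?x * (q' * p)" using less.prems(1) cf by (simp add: mult_ac)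
      then have "smult c' f = q' * p" by (subst (asm) mult_cancel_left) simp
      then show ?thesis using less.hyps[OF deg] \<open>c' \<noteq> 0\<close> by blast
    next
      case 2
      then have "?x * smult c' f = ?x * (q * p')" using less.prems(1) cf by (simp add: mult_ac)
      then have "smult c' f = q * p'" by (subst (asm) mult_cancel_left) simp
      then have "lead_coeff p' dvd coeff p' k" using less.hyps[OF deg] \<open>c' \<noteq> 0\<close> by blast
      then have "[:-x, 1:] * lead_coeff p' dvd [:-x, 1:] * coeff p' k"
        by (rule mult_dvd_mono[OF dvd_refl])
      moreover have "lead_coeff p = [:-x, 1:] * lead_coeff p'"
        unfolding 2 lead_coeff_mult by simp
      moreover have "coeff p k = [:-x, 1:] * coeff p' k"
        unfolding 2 by simp
      ultimately show ?thesis by simp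
    qed
  qed
qed

section \<open>Homogeneous and monic functions on lines\<close>

context
  fixes f :: "'a::{idom, ring_char_0} ^ 'n \<Rightarrow> 'a" and d :: nat
  assumes f: "polyfun f" and hom: "homog d f"
begin

lemma line_poly_homog_zero: "line_poly f 0 w = monom (f w) d"
  by (rule line_poly_unique) (use f hom in \<open>auto simp: poly_monom homog_def mult.commute\<close>)

text \<open>Scaling base point and parameter together by \<open>s\<close> multiplies
  \<open>f\<close> by \<open>s ^ d\<close>. As an identity of polynomials in \<open>s\<close> this
  permits comparing coefficients, where dividing by \<open>s ^ k\<close> would fail at 0.\<close>

lemma monom_mult_line_poly_coeff:
  "monom 1 k * line_poly (\<lambda>x. coeff (line_poly f x w) k) 0 v = monom (coeff (line_poly f v w) k) d"
proof -
  have polE: "polyfun (\<lambda>x. coeff (line_poly f x w) k)"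
    by (rule polyfun_coeff_line_poly[OF f]) (auto intro: polyfun_intros)
  have scale: "pcompose (line_poly f (s *s v) w) [:0, s:] = smult (s ^ d) (line_poly f v w)" for s
    unfolding poly_eq_poly_eq_iff[symmetric]
  proof
    fix t
    have "s *s v + (s * t) *s w = s *s (v + t *s w)" by (simp add: vec_eq_iff algebra_simps)
    then have "f (s *s v + (s * t) *s w) = s ^ d * f (v + t *s w)"
      using hom by (simp only: homog_def)
    then show "poly (pcompose (line_poly f (s *s v) w) [:0, s:]) t
        = poly (smult (s ^ d) (line_poly f v w)) t"
      using f by (simp add: poly_pcompose poly_line_poly mult.commute)
  qed
  show ?thesis
    unfolding poly_eq_poly_eq_iff[symmetric]
  proof
    fix s
    have "s ^ k * coeff (line_poly f (s *s v) w) k = s ^ d * coeff (line_poly f v w) k"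
      using arg_cong[OF scale[of s], of "\<lambda>p. coeff p k"] by (simp add: coeff_pcompose_linear)
    then show "poly (monom 1 k * line_poly (\<lambda>x. coeff (line_poly f x w) k) 0 v) s
        = poly (monom (coeff (line_poly f v w) k) d) s"
      using poly_line_poly[OF polE, of 0 v s] by (simp add: poly_monom mult.commute)
  qed
qed

text \<open>The leading coefficient does not depend on the base point, so it may be computed at 0. A
  form is thus monic, up to a constant, along any direction at which it is nonzero.\<close>

lemma line_poly_homog:
  shows "coeff (line_poly f v w) d = f w" "degree (line_poly f v w) \<le> d"
proof -
  have *: "(if d < k then 0 else coeff (line_poly (\<lambda>x. coeff (line_poly f x w) k) 0 v) (d - k))
    = coeff (line_poly f v w) k" for k
    using arg_cong[OF monom_mult_line_poly_coeff[of k w v], of "\<lambda>p. coeff p d"]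
    by (auto simp: coeff_monom_mult split: if_splits)
  show "degree (line_poly f v w) \<le> d"
  proof (rule degree_le, intro allI impI)
    fix k assume "d < k"
    then show "coeff (line_poly f v w) k = 0" using *[of k] by simp
  qed
  have "coeff (line_poly (\<lambda>x. coeff (line_poly f x w) d) 0 v) 0 = coeff (line_poly f 0 w) d"
    unfolding poly_0_coeff_0[symmetric]
    by (subst poly_line_poly) (auto intro!: polyfun_coeff_line_poly[OF f] polyfun_intros)
  then show "coeff (line_poly f v w) d = f w"
    using *[of d] by (simp add: line_poly_homog_zero)
qed

lemma homog_line_poly_coeff:
  assumes "k \<le> d"
  shows "homog (d - k) (\<lambda>v. coeff (line_poly f v w) k)"
  unfolding homog_def
proof (intro allI)
  fix s v
  have polE: "polyfun (\<lambda>x. coeff (line_poly f x w) k)"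
    by (rule polyfun_coeff_line_poly[OF f]) (auto intro: polyfun_intros)
  have "monom 1 k * line_poly (\<lambda>x. coeff (line_poly f x w) k) 0 v
      = monom 1 k * monom (coeff (line_poly f v w) k) (d - k)"
    using assms by (simp add: monom_mult_line_poly_coeff mult_monom)
  then have "line_poly (\<lambda>x. coeff (line_poly f x w) k) 0 v = monom (coeff (line_poly f v w) k) (d - k)"
    by (subst (asm) mult_cancel_left) simp
  from arg_cong[OF this, of "\<lambda>p. poly p s"]
  show "coeff (line_poly f (s *s v) w) k = s ^ (d - k) * coeff (line_poly f v w) k"
    using polE by (simp add: poly_line_poly poly_monom mult.commute)
qed

end

lemma line_poly_sum:
  fixes f :: "'i \<Rightarrow> 'a::{idom, ring_char_0} ^ 'n \<Rightarrow> 'a"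
  assumes "\<And>i. i \<in> A \<Longrightarrow> polyfun (f i)"
  shows "line_poly (\<lambda>v. \<Sum>i\<in>A. f i v) v w = (\<Sum>i\<in>A. line_poly (f i) v w)"
  by (rule line_poly_unique) (use assms in \<open>auto intro: polyfun_intros simp: poly_sum poly_line_poly\<close>)

text \<open>Only the top homogeneous component contributes to the coefficient of degree
  \<open>D\<close> on a line, so any direction at which it is nonzero will do.\<close>

lemma monic_direction:
  fixes f :: "'a::field_char_0 ^ 'n \<Rightarrow> 'a"
  assumes f: "polyfun f" and nz: "f v0 \<noteq> 0"
  obtains D u where "u \<noteq> 0" "homog_comp D f u \<noteq> 0"
    "\<forall>v. degree (line_poly f v u) = D" "\<forall>v. coeff (line_poly f v u) D = homog_comp D f u"
proof -
  obtain D0 where D0: "\<And>v. f v = (\<Sum>j\<le>D0. homog_comp j f v)" using homog_comp_sum[OF f] by blast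
  define J where "J = {j. j \<le> D0 \<and> (\<exists>v. homog_comp j f v \<noteq> 0)}"
  have "J \<noteq> {}"
  proof
    assume "J = {}"
    then have "homog_comp j f v0 = 0" if "j \<le> D0" for j using that by (auto simp: J_def)
    then have "(\<Sum>j\<le>D0. homog_comp j f v0) = 0" by simp
    then show False using nz D0[of v0] by metis
  qed
  define D where "D = Max J"
  have finJ: "finite J" by (simp add: J_def)
  have D: "D \<in> J" unfolding D_def by (rule Max_in) fact+
  have "(\<Sum>j\<le>D0. homog_comp j f v) = (\<Sum>j\<le>D. homog_comp j f v)" for v
  proof (rule sum.mono_neutral_right)
    show "{..D} \<subseteq> {..D0}" using D by (auto simp: J_def)
    show "\<forall>i\<in>{..D0} - {..D}. homog_comp i f v = 0"
    proof
      fix i assume i: "i \<in> {..D0} - {..D}"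
      then have "i \<notin> J" using Max_ge[OF finJ, of i] by (auto simp: D_def)
      then show "homog_comp i f v = 0" using i by (auto simp: J_def)
    qed
  qed simp
  then have "f v = (\<Sum>j\<le>D. homog_comp j f v)" for v
    using D0[of v] by (rule trans[rotated])
  then have fD: "f = (\<lambda>v. \<Sum>j\<le>D. homog_comp j f v)" by blast
  have line: "line_poly f v u = (\<Sum>j\<le>D. line_poly (homog_comp j f) v u)" for v u
    using line_poly_sum[of "{..D}" "\<lambda>j. homog_comp j f" v u] polyfun_homog_comp[OF f]
    unfolding fD[symmetric] by blast
  note hom = line_poly_homog[OF polyfun_homog_comp[OF f] homog_homog_comp[OF f]]
  from D obtain u' where u': "homog_comp D f u' \<noteq> 0" by (auto simp: J_def)
  obtain u where u: "u \<noteq> 0" "homog_comp D f u \<noteq> 0"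
  \<comment> \<open>A form that is nonzero at 0 has degree 0 and is constant, so any nonzero
    direction serves.\<close>
  proof (cases "u' = 0")
    case True
    have "homog_comp D f (0 *s axis undefined 1) = 0 ^ D * homog_comp D f (axis undefined 1)"
      using homog_homog_comp[OF f] unfolding homog_def by blast
    then have "homog_comp D f (axis undefined 1) \<noteq> 0" using True u' by auto
    then show ?thesis using that[of "axis undefined 1"] by (auto simp: axis_eq_0_iff)
  qed (use that u' in auto)
  have co: "coeff (line_poly f v u) D = homog_comp D f u" for v
  proof -
    have 0: "coeff (line_poly (homog_comp j f) v u) D = 0" if "j < D" for j
      by (rule coeff_eq_0) (rule le_less_trans[OF hom(2) that])
    have "coeff (line_poly f v u) D = (\<Sum>j\<le>D. coeff (line_poly (homog_comp j f) v u) D)"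
      unfolding line[of v u] coeff_sum by (rule refl)
    also have "\<dots> = (\<Sum>j<D. coeff (line_poly (homog_comp j f) v u) D)
        + coeff (line_poly (homog_comp D f) v u) D"
      unfolding lessThan_Suc_atMost[symmetric] sum.lessThan_Suc by (rule refl)
    also have "\<dots> = homog_comp D f u"
      using 0 unfolding hom(1) by simp
    finally show ?thesis .
  qed
  have "degree (line_poly f v u) \<le> D" for v
    unfolding line
  proof (rule degree_sum_le)
    fix j assume "j \<in> {..D}"
    then show "degree (line_poly (homog_comp j f) v u) \<le> D"
      using hom(2)[of j v u] by simp
  qed simp
  moreover have "degree (line_poly f v u) \<ge> D" for v
    by (rule le_degree) (simp add: co u)
  ultimately have "degree (line_poly f v u) = D" for v by (rule antisym)
  with co show ?thesis by (intro that[OF u] allI)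
qed

context direction
begin

lemma line_poly_expn:
  assumes "coefs c"
  shows "line_poly (expn c n) v w = (\<Sum>k<n. smult (c k v) ([:lam v, 1:] ^ k))"
  by (rule line_poly_unique[OF polyfun_expn[OF assms]])
    (simp add: expn_def poly_sum coefsD(2)[OF assms] lam_add add.commute)

lemma degree_line_poly_expn:
  assumes "coefs c" "line_poly (expn c n) v w \<noteq> 0"
  shows "degree (line_poly (expn c n) v w) < n"
proof -
  have "n > 0" using assms by (intro gr0I) (simp add: line_poly_expn)
  have "degree (line_poly (expn c n) v w) \<le> n - 1"
    unfolding line_poly_expn[OF assms(1)]
    by (rule degree_sum_le)
      (auto intro!: order_trans[OF degree_smult_le] order_trans[OF degree_power_le])
  then show ?thesis using \<open>n > 0\<close> by simp
qed

text \<open>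
  Division with remainder by a function that is monic in the given direction is uniform in the
  line, so divisibility may be tested on the lines in that direction.
\<close>

lemma dvd_of_line_dvd:
  assumes l: "polyfun l" "\<And>v. degree (line_poly l v w) = D" "\<And>v. coeff (line_poly l v w) D = a"
    "a \<noteq> 0" and c: "polyfun c" "\<And>v. line_poly l v w dvd line_poly c v w"
  shows "\<exists>q. polyfun q \<and> (\<forall>v. c v = l v * q v)"
proof -
  obtain L where L: "coefs L" "\<And>v. l v = expn L (Suc D) v"
    "\<And>k v. L k v = coeff (line_poly l (v - lam v *s w) w) k"
    by (rule expansion_degree[OF l(1), of D]) (use l(2) in auto)
  obtain n g where g: "coefs g" "\<And>v. c v = expn g n v" using expansion[OF c(1)] by blast
  obtain K q r where q: "coefs q" "coefs r"
    "\<And>v. L D v ^ K * expn g n v = expn q (n - D) v * expn L (Suc D) v + expn r D v"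
    using pseudo_division[OF L(1) g(1), of D n] by blast
  have eq: "a ^ K * c v = expn q (n - D) v * l v + expn r D v" for v
    using q(3)[of v] by (simp add: L(3) l(3) flip: L(2) g(2))
  have r0: "expn r D v = 0" for v
  proof -
    have "line_poly (expn r D) v w
        = smult (a ^ K) (line_poly c v w) - line_poly (expn q (n - D)) v w * line_poly l v w"
      by (rule line_poly_unique[OF polyfun_expn[OF q(2)]])
        (use eq in \<open>simp add: poly_line_poly l c polyfun_expn[OF q(1)]\<close>)
    then have "line_poly l v w dvd line_poly (expn r D) v w"
      using c(2)[of v] by (simp add: dvd_smult)
    then have "line_poly (expn r D) v w = 0"
      using dvd_imp_degree_le[of "line_poly l v w" "line_poly (expn r D) v w"]
        degree_line_poly_expn[OF q(2), of D v] l(2)[of v] by fastforce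
    then show ?thesis
      using poly_line_poly[OF polyfun_expn[OF q(2)], of D v w 0] by simp
  qed
  show ?thesis
  proof (intro exI[of _ "\<lambda>v. inverse (a ^ K) * expn q (n - D) v"] conjI allI)
    show "polyfun (\<lambda>v. inverse (a ^ K) * expn q (n - D) v)"
      by (intro polyfun_intros polyfun_expn q)
    fix v show "c v = l v * (inverse (a ^ K) * expn q (n - D) v)"
      using eq[of v] r0[of v] l(4) by (simp add: field_simps)
  qed
qed

end

lemma polyfun_cancel:
  fixes l :: "'a::{idom, ring_char_0} ^ 'n \<Rightarrow> 'a"
  assumes "polyfun l" "l v0 \<noteq> 0" "polyfun f" "polyfun g" "\<And>v. l v * f v = l v * g v"
  shows "f v = g v"
  using irreducible_setD[OF irreducible_set_UNIV assms(1) polyfun_diff[OF assms(3,4)]] assms(2,5)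
  by (auto simp: right_diff_distrib)


section \<open>The ideal of an irreducible hypersurface is principal\<close>

locale direction_alg_closed = direction w lam
  for w :: "'a::{alg_closed_field, field_char_0} ^ 'n" and lam
begin

text \<open>Reduction to two variables: the coefficients are restricted to the line through
  \<open>v\<close> in direction \<open>u\<close>, and \<open>lam\<close> stays as the main variable.
  Then \<open>lead_coeff_dvd_coeff\<close> applies.\<close>

lemma expn_dvd_lead:
  assumes coefs: "coefs p" "coefs q" "coefs F"
    and eq: "\<And>v. l v ^ K * expn F (Suc d) v = expn q n v * expn p (Suc m) v"
    and l: "polyfun l" "winv l" "\<And>v. l v = p m v"
    and a: "\<And>v. F d v = a" "a \<noteq> 0"
    and nz: "line_poly l v u \<noteq> 0" and k: "k \<le> m"
  shows "line_poly l v u dvd line_poly (p k) v u"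
proof -
  define bar where "bar c n = (\<Sum>k<n. monom (line_poly (c k) v u) k)" for c n
  have coeff_bar: "coeff (bar c n) k = (if k < n then line_poly (c k) v u else 0)" for c n k
    by (simp add: bar_def coeff_sum coeff_monom if_distrib sum.delta cong: if_cong)
  \<comment> \<open>The point in direction \<open>w\<close> from \<open>v + s *s u\<close> at which
    \<open>lam\<close> takes the value \<open>t\<close>.\<close>
  define y where "y s t = (v + s *s u) + (t - lam (v + s *s u)) *s w" for s t
  have lam_y: "lam (y s t) = t" for s t unfolding y_def lam_add by simp
  have inv: "g (y s t) = g (v + s *s u)" if "winv g" for g s t
    using that unfolding winv_def y_def by blast
  have poly_bar: "poly (poly (bar c n) [:t:]) s = expn c n (y s t)" if "coefs c" for c n s t
    unfolding bar_def poly_sum poly_monom expn_def lam_y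
    using that by (intro sum.cong refl) (simp add: coefs_def inv poly_line_poly)
  have "smult (line_poly l v u ^ K) (bar F (Suc d)) = bar q n * bar p (Suc m)"
  proof (rule poly_poly_eqI)
    fix s t
    have "l (v + s *s u) ^ K * expn F (Suc d) (y s t) = expn q n (y s t) * expn p (Suc m) (y s t)"
      using eq[of "y s t"] inv[OF l(2)] by simp
    then show "poly (poly (smult (line_poly l v u ^ K) (bar F (Suc d))) [:t:]) s
        = poly (poly (bar q n * bar p (Suc m)) [:t:]) s"
      using coefs l by (simp add: poly_bar poly_line_poly poly_power)
  qed
  moreover have "line_poly l v u ^ K \<noteq> 0" using nz by simp
  moreover have "line_poly (F d) v u = [:a:]"
    by (rule line_poly_unique) (use coefs a in \<open>auto simp: coefs_def\<close>)
  then have top: "coeff (bar F (Suc d)) d = [:a:]" by (simp add: coeff_bar)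
  have "degree (bar F (Suc d)) = d"
    by (rule antisym[OF degree_le le_degree]) (use top a(2) in \<open>auto simp: coeff_bar\<close>)
  then have "lead_coeff (bar F (Suc d)) = [:a:]" using top by simp
  ultimately have *: "lead_coeff (bar p (Suc m)) dvd coeff (bar p (Suc m)) k"
    using a(2) by (rule lead_coeff_dvd_coeff)
  have "l = p m" using l(3) by blast
  then have top: "coeff (bar p (Suc m)) m = line_poly l v u" by (simp add: coeff_bar)
  have "degree (bar p (Suc m)) = m"
    by (rule antisym[OF degree_le le_degree]) (use top nz in \<open>auto simp: coeff_bar\<close>)
  with * show ?thesis using k top by (simp add: coeff_bar)
qed

end

text \<open>Compare the least degree \<open>d\<close> of a nonzero form in the ideal with the degree
  \<open>m\<close> of the minimal equation along \<open>w\<close>. Once \<open>d \<le> m\<close> is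
  known, \<open>f\<close> is itself a minimal equation, and its constant leading coefficient makes
  division by it exact.\<close>

lemma principal_ideal:
  fixes Z :: "('a::{alg_closed_field, field_char_0} ^ 'n) set"
  assumes Z: "irreducible_set Z" and cone: "\<And>c z. z \<in> Z \<Longrightarrow> c *s z \<in> Z"
    and f0: "polyfun f0" "homog D f0" "D > 0" "f0 v0 \<noteq> 0"
    and cl: "zariski_closure Z = {v. f0 v = 0}"
  obtains f d where "polyfun f" "homog d f" "vanishes_on f Z" "\<exists>v. f v \<noteq> 0"
    "\<forall>g. polyfun g \<longrightarrow> vanishes_on g Z \<longrightarrow> (\<exists>q. polyfun q \<and> (\<forall>v. g v = q v * f v))"
proof -
  define A where "A = {j. \<exists>g. polyfun g \<and> homog j g \<and> vanishes_on g Z \<and> (\<exists>v. g v \<noteq> 0)}"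
  have "vanishes_on f0 Z" using subset_zariski_closure[of Z] cl by auto
  then have "D \<in> A" using f0 by (auto simp: A_def)
  define d where "d = (LEAST j. j \<in> A)"
  have "d \<in> A" unfolding d_def using \<open>D \<in> A\<close> by (rule LeastI)
  then obtain f v1 where f: "polyfun f" "homog d f" "vanishes_on f Z" "f v1 \<noteq> 0"
    by (auto simp: A_def)
  have dmin: "d \<le> j" if "j \<in> A" for j unfolding d_def using that by (rule Least_le)
  \<comment> \<open>The first condition makes \<open>f\<close> monic along \<open>w\<close> up to a
    constant; the second makes every line in direction \<open>w\<close> meet the zero set of
    \<open>f0\<close>.\<close>
  obtain w where w: "f w \<noteq> 0" "f0 w \<noteq> 0"
    using irreducible_set_mult[OF irreducible_set_UNIV f(1) f0(1)] f(4) f0(4) by auto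
  have "w \<noteq> 0"
  proof
    assume "w = 0"
    have "f0 (0 *s w) = 0 ^ D * f0 w" using f0(2) unfolding homog_def by blast
    then have "f0 0 = 0" using f0(3) by simp
    then show False using \<open>w = 0\<close> w(2) by simp
  qed
  obtain lam where dir: "direction w lam" and lam0: "lam 0 = 0"
    by (rule direction_exists[OF \<open>w \<noteq> 0\<close>])
  interpret direction_alg_closed w lam by (rule direction_alg_closed.intro[OF dir])
  \<comment> \<open>Each line in direction \<open>w\<close> contains a point of the closure of
    \<open>Z\<close>, and invariance spreads the zero of \<open>g\<close> along the line. Hence the
    remainders below are identically zero.\<close>
  have inv0: "g v = 0" if g: "polyfun g" "winv g" "vanishes_on g Z" for g v
  proof -
    have "degree (line_poly f0 v w) > 0"
      using le_degree[of "line_poly f0 v w" D] line_poly_homog(1)[OF f0(1,2)] w(2) f0(3) by force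
    then obtain t where "poly (line_poly f0 v w) t = 0" using alg_closed_imp_poly_has_root by blast
    then have "v + t *s w \<in> zariski_closure Z" using f0 cl by (simp add: poly_line_poly)
    then have "g (v + t *s w) = 0" using g by (auto dest: zariski_closureD)
    then show ?thesis using g(2) by (simp add: winv_def)
  qed
  obtain F where F: "coefs F" "\<And>v. f v = expn F (Suc d) v"
    "\<And>k v. F k v = coeff (line_poly f (v - lam v *s w) w) k"
    by (rule expansion_degree[OF f(1), of d]) (use line_poly_homog(2)[OF f(1,2)] in auto)
  have Fd: "F d v = f w" for v unfolding F(3) by (rule line_poly_homog(1)[OF f(1,2)])
  obtain z where z: "z \<in> Z" using irreducible_set_nonempty[OF Z] by blast
  have "line_poly f z w \<noteq> 0" using line_poly_homog(1)[OF f(1,2), of z w] w by auto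
  then obtain t where t: "f (z + t *s w) \<noteq> 0"
    using poly_line_poly[OF f(1), of z w] by (metis poly_0 poly_eq_poly_eq_iff ext)
  obtain m p where mp: "minimal_equation Z p m"
    by (rule minimal_equation_exists[OF f(1,3) z t])
  have p: "coefs p" "\<not> vanishes_on (p m) Z" "vanishes_on (expn p (Suc m)) Z"
    using mp by (auto simp: minimal_equation_def)
  have pm: "polyfun (p m)" "winv (p m)" using p(1) by (auto simp: coefs_def)
  obtain z1 where z1: "p m z1 \<noteq> 0" using p(2) by blast
  \<comment> \<open>A power of \<open>p m\<close> times \<open>f\<close> is a multiple of the
    minimal equation. As \<open>f\<close> is monic along \<open>w\<close> up to a constant, Gauss's
    lemma makes all coefficients of the minimal equation divisible by the leading one. The quotient
    is monic, and its part of degree \<open>m\<close> is a nonzero form in the ideal.\<close>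
  have "d \<le> m"
  proof -
    obtain K q r where q: "polyfun q" "coefs r" "\<forall>k<m. vanishes_on (r k) Z"
      "\<forall>v. p m v ^ K * f v = q v * expn p (Suc m) v + expn r m v"
      by (rule minimal_equation_division[OF mp f(1,3)])
    have r0: "expn r m v = 0" for v
      by (rule expn_vanishes, rule inv0) (use q(2,3) in \<open>auto simp: coefs_def\<close>)
    obtain n Q where Q: "coefs Q" "\<And>v. q v = expn Q n v" using expansion[OF q(1)] by blast
    have eq: "p m v ^ K * expn F (Suc d) v = expn Q n v * expn p (Suc m) v" for v
      using q(4) r0 F(2) Q(2) by simp
    obtain E u where u: "u \<noteq> 0" "homog_comp E (p m) u \<noteq> 0"
      "\<forall>v. degree (line_poly (p m) v u) = E"
      "\<forall>v. coeff (line_poly (p m) v u) E = homog_comp E (p m) u"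
      by (rule monic_direction[OF pm(1) z1])
    obtain mu where mu: "direction u mu" by (rule direction_exists[OF u(1)])
    have "\<exists>c. polyfun c \<and> (\<forall>v. p k v = p m v * c v)" if "k \<le> m" for k
    proof (rule direction.dvd_of_line_dvd[OF mu pm(1) u(3,4)[rule_format] u(2)])
      show "polyfun (p k)" using p(1) by (simp add: coefs_def)
      fix v
      have "line_poly (p m) v u \<noteq> 0" using u(2) u(4)[rule_format, of v] by auto
      then show "line_poly (p m) v u dvd line_poly (p k) v u"
        by (rule expn_dvd_lead[OF p(1) Q(1) F(1) eq pm refl Fd w(1) _ that])
    qed
    then obtain c where c: "\<And>k. k \<le> m \<Longrightarrow> polyfun (c k)"
      "\<And>k v. k \<le> m \<Longrightarrow> p k v = p m v * c k v"
      by metis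
    define p' where "p' k = (if k < m then c k else (\<lambda>_. 1))" for k
    have p'eq: "p k v = p m v * p' k v" if "k \<le> m" for k v
      using c(2)[OF that, of v] that by (auto simp: p'_def)
    have pol': "polyfun (p' k)" for k using c(1) by (auto simp: p'_def intro: polyfun_intros)
    have p': "coefs p'"
      unfolding coefs_def
    proof (intro allI conjI pol')
      fix k show "winv (p' k)"
      proof (cases "k < m")
        case True
        have "p' k (v + t *s w) = p' k v" for v t
        proof (rule polyfun_cancel[OF pm(1) z1 polyfun_translate[OF pol'] pol'])
          fix x
          show "p m x * p' k (x + t *s w) = p m x * p' k x"
            using p'eq[of k x, symmetric] p'eq[of k "x + t *s w", symmetric] True
            by (simp only: coefsD(2)[OF p(1)] less_imp_le)
        qed
        then show ?thesis by (simp add: winv_def)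
      qed (simp add: p'_def winv_def)
    qed
    have "vanishes_on (\<lambda>v. p m v * expn p' (Suc m) v) Z"
    proof
      fix z assume "z \<in> Z"
      have "p m z * expn p' (Suc m) z = expn p (Suc m) z"
        unfolding expn_def sum_distrib_left
      proof (rule sum.cong[OF refl])
        fix k assume "k \<in> {..<Suc m}"
        then have "p k z = p m z * p' k z" by (intro p'eq) simp
        then show "p m z * (p' k z * lam z ^ k) = p k z * lam z ^ k" by (simp only: mult.assoc)
      qed
      then show "p m z * expn p' (Suc m) z = 0" using p(3) \<open>z \<in> Z\<close> by simp
    qed
    with irreducible_setD[OF Z pm(1) polyfun_expn[OF p']] p(2)
    have van': "vanishes_on (expn p' (Suc m)) Z" by blast
    let ?h = "homog_comp m (expn p' (Suc m))"
    have "m \<in> A"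
      unfolding A_def
    proof (intro CollectI exI[of _ ?h] conjI)
      show "polyfun ?h" "homog m ?h"
        by (intro polyfun_homog_comp homog_homog_comp polyfun_expn p')+
      \<comment> \<open>\<open>Z\<close> is a cone, so the quotient vanishes on the line through 0
        and \<open>z\<close>, and every component vanishes at \<open>z\<close>.\<close>
      show "vanishes_on ?h Z"
      proof
        fix z assume "z \<in> Z"
        have "line_poly (expn p' (Suc m)) 0 z = 0"
          by (rule line_poly_unique[OF polyfun_expn[OF p']])
            (use van' cone[OF \<open>z \<in> Z\<close>] in simp)
        then show "?h z = 0" by (simp add: homog_comp_def)
      qed
      \<comment> \<open>Since \<open>lam 0 = 0\<close>, the parameter on this line is
        \<open>lam\<close> itself and the top coefficient is 1.\<close>
      have "line_poly (expn p' (Suc m)) 0 w = (\<Sum>k<Suc m. monom (p' k 0) k)"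
      proof (rule line_poly_unique[OF polyfun_expn[OF p']])
        fix t
        show "poly (\<Sum>k<Suc m. monom (p' k 0) k) t = expn p' (Suc m) (0 + t *s w)"
          unfolding expn_def lam_add lam0 coefsD(2)[OF p'] by (simp add: poly_sum poly_monom)
      qed
      then have "?h w = p' m 0"
        by (simp add: homog_comp_def coeff_sum coeff_monom)
      then have "?h w = 1" by (simp add: p'_def)
      then show "\<exists>v. ?h v \<noteq> 0" by (intro exI[of _ w]) simp
    qed
    then show ?thesis by (rule dmin)
  qed
  have mF: "minimal_equation Z F d"
    unfolding minimal_equation_def
  proof (intro conjI allI impI)
    show "coefs F" by fact
    show "\<not> vanishes_on (F d) Z" using Fd w(1) z by auto
    show "vanishes_on (expn F (Suc d)) Z" using F(2) f(3) by simp
    fix k s assume "k < d" "coefs s" "vanishes_on (expn s (Suc k)) Z"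
    then show "vanishes_on (s k) Z" using mp \<open>d \<le> m\<close> unfolding minimal_equation_def by simp
  qed
  have div: "\<exists>q. polyfun q \<and> (\<forall>v. g v = q v * f v)" if g: "polyfun g" "vanishes_on g Z" for g
  proof -
    obtain K q r where q: "polyfun q" "coefs r" "\<forall>k<d. vanishes_on (r k) Z"
      "\<forall>v. F d v ^ K * g v = q v * expn F (Suc d) v + expn r d v"
      by (rule minimal_equation_division[OF mF g])
    have r0: "expn r d v = 0" for v
      by (rule expn_vanishes, rule inv0) (use q(2,3) in \<open>auto simp: coefs_def\<close>)
    have eq: "f w ^ K * g v = q v * f v" for v
      using q(4) r0 F(2) Fd by simp
    show ?thesis
    proof (intro exI[of _ "\<lambda>v. inverse (f w ^ K) * q v"] conjI allI)
      show "polyfun (\<lambda>v. inverse (f w ^ K) * q v)" by (intro polyfun_intros q)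
      fix v show "g v = inverse (f w ^ K) * q v * f v"
        using eq[of v] w(1) by (simp add: field_simps)
    qed
  qed
  show ?thesis
  proof (rule that[OF f(1,2,3)])
    show "\<exists>v. f v \<noteq> 0" using f(4) by blast
    show "\<forall>g. polyfun g \<longrightarrow> vanishes_on g Z \<longrightarrow> (\<exists>q. polyfun q \<and> (\<forall>v. g v = q v * f v))"
      using div by blast
  qed
qed


section \<open>Sums of elements of a cone\<close>

text \<open>Take a linear map that fixes \<open>v\<close> and kills a basis of \<open>T\<close>; a
  row of its matrix where \<open>v\<close> has a nonzero coordinate is the functional.\<close>

lemma nontrivial_functional_on_subspace:
  fixes T :: "('a::field ^ 'n) set"
  assumes T: "vec.subspace T" and v: "v \<notin> T"
  obtains a where "a \<noteq> 0" "\<forall>x\<in>T. (\<Sum>i\<in>UNIV. a $ i * x $ i) = 0"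
proof -
  obtain B where B: "B \<subseteq> T" "vec.independent B" "T \<subseteq> vec.span B"
    using vec.basis_exists[of T] by metis
  have "vec.span B \<subseteq> T" using B(1) T by (rule vec.span_minimal)
  then have "v \<notin> vec.span B" using v by blast
  then have ind: "vec.independent (insert v B)" using B(2) by (rule vec.independent_insertI)
  obtain g where g: "Vector_Spaces.linear (*s) (*s) g"
    "\<forall>x\<in>insert v B. g x = (if x = v then v else 0)"
    using vec.linear_independent_extend[OF ind, of "\<lambda>x. if x = v then v else 0"] by metis
  have "v \<noteq> 0" using v vec.subspace_0[OF T] by auto
  then obtain i where i: "v $ i \<noteq> 0" by (auto simp: vec_eq_iff)
  have mw: "(\<Sum>j\<in>UNIV. matrix g $ i $ j * x $ j) = g x $ i" for x
  proof -
    have "(matrix g *v x) $ i = g x $ i" by (simp only: matrix_works[OF g(1)])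
    then show ?thesis by (simp only: matrix_vector_mult_def vec_lambda_beta)
  qed
  show ?thesis
  proof (rule that[of "matrix g $ i"])
    show "matrix g $ i \<noteq> 0"
    proof
      assume "matrix g $ i = 0"
      then have "g v $ i = 0" using mw[of v] by simp
      then show False using g(2) i by simp
    qed
    show "\<forall>x\<in>T. (\<Sum>j\<in>UNIV. matrix g $ i $ j * x $ j) = 0"
    proof
      fix x assume "x \<in> T"
      then have "x \<in> vec.span B" using B by blast
      moreover have "g b = 0" if "b \<in> B" for b
        using g(2) that \<open>v \<notin> vec.span B\<close> vec.span_base[of b B] by auto
      ultimately have "g x = 0" using vec.linear_eq_0_on_span[OF g(1)] by blast
      then show "(\<Sum>j\<in>UNIV. matrix g $ i $ j * x $ j) = 0" using mw by simp
    qed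
  qed
qed

fun sums_of :: "'a::monoid_add set \<Rightarrow> nat \<Rightarrow> 'a set" where
  "sums_of C 0 = {0}"
| "sums_of C (Suc k) = sumset C (sums_of C k)"

lemma sums_of_add:
  "x \<in> sums_of C k \<Longrightarrow> y \<in> sums_of C l \<Longrightarrow> x + y \<in> sums_of C (k + l)"
proof (induction k arbitrary: x)
  case (Suc k)
  then obtain c x' where "c \<in> C" "x' \<in> sums_of C k" "x = c + x'" by (auto simp: sumset_def)
  then show ?case using Suc.IH[OF _ Suc.prems(2)] by (auto simp: add.assoc intro: sumsetI)
qed simp

lemma sums_of_mono:
  assumes "0 \<in> C" "k \<le> l"
  shows "sums_of C k \<subseteq> sums_of C l"
proof
  fix x assume x: "x \<in> sums_of C k"
  have "0 \<in> sums_of C j" for j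
    by (induction j) (use assms(1) sumsetI[of 0 C 0] in \<open>auto\<close>)
  from sums_of_add[OF x this, of "l - k"] show "x \<in> sums_of C l" using assms(2) by simp
qed

lemma sums_of_scale:
  fixes C :: "('a::field ^ 'n) set"
  assumes "\<And>c x. x \<in> C \<Longrightarrow> c *s x \<in> C"
  shows "x \<in> sums_of C k \<Longrightarrow> c *s x \<in> sums_of C k"
proof (induction k arbitrary: x)
  case (Suc k)
  then obtain y x' where "y \<in> C" "x' \<in> sums_of C k" "x = y + x'" by (auto simp: sumset_def)
  then show ?case using Suc.IH assms by (auto simp: vec.scale_right_distrib intro: sumsetI)
qed simp

locale nondegenerate_cone =
  fixes C :: "('a::{alg_closed_field, field_char_0} ^ 'n::finite) set"
  assumes irr: "irreducible_set C"
    and closed: "zariski_closure C \<subseteq> C"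
    and cone: "\<And>c x. x \<in> C \<Longrightarrow> c *s x \<in> C"
    and nondegenerate: "\<And>a. a \<noteq> 0 \<Longrightarrow> \<exists>x\<in>C. (\<Sum>i\<in>UNIV. a $ i * x $ i) \<noteq> 0"
begin

lemma zero_mem: "0 \<in> C"
  using irreducible_set_nonempty[OF irr] cone[of _ 0] by auto

lemma irr_sums: "irreducible_set (sums_of C k)"
  by (induction k) (auto intro: irreducible_set_singleton irreducible_set_sumset irr)

lemma closure_singleton: "zariski_closure {0 :: 'a ^ 'n} \<subseteq> {0}"
proof
  fix v :: "'a ^ 'n" assume v: "v \<in> zariski_closure {0}"
  have "v $ i = 0" for i
    using zariski_closureD[OF v polyfun.coord[of i]] by simp
  then show "v \<in> {0}" by (simp add: vec_eq_iff)
qed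

lemma open_sums: "contains_open (sums_of C k)"
proof (induction k)
  case 0
  then show ?case
    unfolding contains_open_def using closure_singleton
    by (intro exI[of _ "\<lambda>_. 1"]) (auto intro: polyfun_intros)
next
  case (Suc k)
  have "contains_open C"
    unfolding contains_open_def using closed zero_mem
    by (intro exI[of _ "\<lambda>_. 1"]) (auto intro: polyfun_intros)
  with Suc show ?case by (auto intro: contains_open_sumset irr irr_sums)
qed

text \<open>The union of all sets of sums is a subspace containing \<open>C\<close>; if it were
  proper, a linear form would vanish on it, against nondegeneracy.\<close>

lemma exists_sum: "\<exists>k. v \<in> sums_of C k"
proof (rule ccontr)
  assume v: "\<nexists>k. v \<in> sums_of C k"
  have "vec.subspace (\<Union>k. sums_of C k)"
    unfolding vec.subspace_def
  proof (intro conjI ballI allI)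
    show "0 \<in> (\<Union>k. sums_of C k)" by (auto intro: exI[of _ 0])
    show "x + y \<in> (\<Union>k. sums_of C k)" if "x \<in> (\<Union>k. sums_of C k)" "y \<in> (\<Union>k. sums_of C k)" for x y
      using that sums_of_add by blast
    show "c *s x \<in> (\<Union>k. sums_of C k)" if "x \<in> (\<Union>k. sums_of C k)" for c x
      using that sums_of_scale[OF cone] by blast
  qed
  moreover have "v \<notin> (\<Union>k. sums_of C k)" using v by blast
  ultimately obtain a where a: "a \<noteq> 0"
    "\<forall>x\<in>(\<Union>k. sums_of C k). (\<Sum>i\<in>UNIV. a $ i * x $ i) = 0"
    by (rule nontrivial_functional_on_subspace)
  have "C \<subseteq> sums_of C 1" using sumsetI[of _ C 0 "{0}"] by auto
  then have "C \<subseteq> (\<Union>k. sums_of C k)" by blast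
  then show False using a(2) nondegenerate[OF a(1)] by blast
qed

end

section \<open>The equation of the secant hypersurface\<close>

locale secant_hypersurface = nondegenerate_cone C
  for C :: "('a::{alg_closed_field, field_char_0} ^ 'n::finite) set" +
  fixes r :: nat and f0 :: "'a ^ 'n \<Rightarrow> 'a" and D :: nat
  assumes r: "r \<ge> 1"
    and f0: "polyfun f0" "homog D f0" "D > 0" "\<exists>v. f0 v \<noteq> 0"
    and closure_eq: "zariski_closure (sums_of C r) = {v. f0 v = 0}"
begin

lemma equation_exists:
  "\<exists>f d. polyfun f \<and> homog d f \<and> vanishes_on f (sums_of C r) \<and> (\<exists>v. f v \<noteq> 0) \<and>
    (\<forall>g. polyfun g \<longrightarrow> vanishes_on g (sums_of C r) \<longrightarrow> (\<exists>q. polyfun q \<and> (\<forall>v. g v = q v * f v)))"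
proof -
  obtain v0 where v0: "f0 v0 \<noteq> 0" using f0(4) by blast
  obtain f d where "polyfun f" "homog d f" "vanishes_on f (sums_of C r)" "\<exists>v. f v \<noteq> 0"
    "\<forall>g. polyfun g \<longrightarrow> vanishes_on g (sums_of C r) \<longrightarrow> (\<exists>q. polyfun q \<and> (\<forall>v. g v = q v * f v))"
    by (rule principal_ideal[OF irr_sums sums_of_scale[OF cone] f0(1-3) v0 closure_eq])
  then show ?thesis by (intro exI[of _ f] exI[of _ d] conjI)
qed

end

text \<open>The generator is a parameter, so that the results can be applied to the very equation by
  which degree and multiplicity are defined.\<close>

locale secant_equation = secant_hypersurface C r f0 D
  for C :: "('a::{alg_closed_field, field_char_0} ^ 'n::finite) set" and r f0 D +
  fixes f :: "'a ^ 'n \<Rightarrow> 'a" and d :: nat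
  assumes f: "polyfun f" "homog d f" "vanishes_on f (sums_of C r)" "\<exists>v. f v \<noteq> 0"
    and divides: "\<And>g. polyfun g \<Longrightarrow> vanishes_on g (sums_of C r) \<Longrightarrow>
      \<exists>q. polyfun q \<and> (\<forall>v. g v = q v * f v)"
begin

text \<open>The measure that decreases under repeated division by \<open>f\<close>.\<close>

lemma degree_line_poly_multiple:
  assumes "polyfun q" "\<And>v. h v = q v * f v" "h v \<noteq> 0" "f w \<noteq> 0"
  shows "degree (line_poly h v w) \<ge> degree (line_poly q v w) + d"
proof -
  have h: "h = (\<lambda>v. q v * f v)" using assms(2) by (rule ext)
  then have eq: "line_poly h v w = line_poly q v w * line_poly f v w"
    using line_poly_mult[OF assms(1) f(1)] by simp
  have "polyfun h" unfolding h by (intro polyfun_intros assms f)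
  then have "line_poly h v w \<noteq> 0"
    using poly_line_poly[of h v w 0] assms(3) by auto
  moreover have "degree (line_poly f v w) \<ge> d"
    by (rule le_degree) (simp add: line_poly_homog(1)[OF f(1,2)] assms(4))
  ultimately show ?thesis unfolding eq by (subst degree_mult_eq) auto
qed

text \<open>Applied to the coefficients of \<open>f\<close> on lines in direction \<open>q\<close>:
  from the linear one on, they are forms of degree below \<open>d\<close>, so a nonzero one cannot
  vanish on the sums.\<close>

lemma minimal:
  assumes "polyfun g" "homog j g" "vanishes_on g (sums_of C r)" "j < d"
  shows "g v = 0"
proof (rule ccontr)
  assume "g v \<noteq> 0"
  obtain w where "f w \<noteq> 0" using f(4) by blast
  obtain q where "polyfun q" "\<And>v. g v = q v * f v" using divides[OF assms(1,3)] by blast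
  then have "d \<le> degree (line_poly g v w)"
    using degree_line_poly_multiple[of q g v w] \<open>g v \<noteq> 0\<close> \<open>f w \<noteq> 0\<close> by simp
  then show False using line_poly_homog(2)[OF assms(1,2), of v w] assms(4) by simp
qed

lemma C_subset: "k \<ge> 1 \<Longrightarrow> C \<subseteq> sums_of C k"
proof -
  assume "k \<ge> 1"
  have "C \<subseteq> sums_of C 1" using sumsetI[of _ C 0 "{0}"] by auto
  with sums_of_mono[OF zero_mem \<open>k \<ge> 1\<close>] show ?thesis by blast
qed

lemma d_pos: "d > 0"
proof (rule gr0I)
  assume "d = 0"
  then have "f (0 *s v) = 0 ^ 0 * f v" for v using f(2) unfolding homog_def by blast
  moreover have "f 0 = 0" using f(3) C_subset[OF r] zero_mem by blast
  ultimately have "f v = 0" for v by simp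
  then show False using f(4) by blast
qed

lemma f_zero: "f 0 = 0"
  using f(3) C_subset[OF r] zero_mem by blast

lemma closure_iff: "v \<in> zariski_closure (sums_of C r) \<longleftrightarrow> f v = 0"
proof
  assume "v \<in> zariski_closure (sums_of C r)"
  then show "f v = 0" by (rule zariski_closureD[OF _ f(1,3)])
next
  assume "f v = 0"
  have "vanishes_on f0 (sums_of C r)"
    using closure_eq subset_zariski_closure[of "sums_of C r"] by blast
  then obtain q where "\<forall>v. f0 v = q v * f v" using divides[OF f0(1)] by blast
  then have "f0 v = 0" using \<open>f v = 0\<close> by simp
  then show "v \<in> zariski_closure (sums_of C r)" by (simp add: closure_eq)
qed

lemma vanishes_on_zeros:
  assumes "polyfun g" "vanishes_on g (sums_of C r)" "f v = 0"
  shows "g v = 0"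
  using assms closure_iff by (auto dest: zariski_closureD)

text \<open>A linear equation would place \<open>C\<close> in a hyperplane. The bound makes a form
  of degree \<open>d - 1\<close> vanish at 0.\<close>

lemma degree_ge_2: "d \<ge> 2"
proof (rule ccontr)
  assume "\<not> ?thesis"
  then have d1: "d = 1" using d_pos by simp
  have add: "f (v + u) = f v + f u" for v u
  proof -
    have "degree (line_poly f v u) \<le> 1" using line_poly_homog(2)[OF f(1,2)] d1 by simp
    then have "poly (line_poly f v u) 1 = poly (line_poly f v u) 0 + coeff (line_poly f v u) 1"
      by (subst poly_eq_sum_bound, assumption) (simp add: poly_0_coeff_0)
    then show ?thesis
      using line_poly_homog(1)[OF f(1,2), of v u] d1 f(1) by (simp add: poly_line_poly)
  qed
  have "f (\<Sum>i\<in>A. h i) = (\<Sum>i\<in>A. f (h i))" if "finite A" for A :: "'n set" and h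
    using that by induction (auto simp: f_zero add)
  then have exp: "f (\<Sum>i\<in>UNIV. v $ i *s axis i 1) = (\<Sum>i\<in>UNIV. f (v $ i *s axis i 1))" for v
    by simp
  define a where "a = (\<chi> i. f (axis i 1))"
  have lin: "f v = (\<Sum>i\<in>UNIV. a $ i * v $ i)" for v
  proof -
    have "f (c *s v) = c * f v" for c v using f(2) d1 by (simp add: homog_def)
    with exp[of v] show ?thesis by (simp add: basis_expansion a_def mult.commute)
  qed
  have "a \<noteq> 0"
  proof
    assume "a = 0"
    then have "f v = 0" for v using lin[of v] by simp
    then show False using f(4) by blast
  qed
  from nondegenerate[OF this] obtain x where "x \<in> C" "f x \<noteq> 0"
    by (auto simp: lin)
  then show False using f(3) C_subset[OF r] by blast
qed

text \<open>
  If \<open>f\<close> does not vanish on \<open>Z\<close>, a function vanishing on \<open>Z\<close> could be divided by \<open>f\<close> forever.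
\<close>

lemma dense_overset:
  assumes Z: "irreducible_set Z" "sums_of C r \<subseteq> Z" and h: "polyfun h" "vanishes_on h Z"
    and "\<not> vanishes_on f Z"
  shows "h v = 0"
proof (rule ccontr)
  assume "h v \<noteq> 0"
  obtain w where w: "f w \<noteq> 0" using f(4) by blast
  show False using h \<open>h v \<noteq> 0\<close>
  proof (induction "degree (line_poly h v w)" arbitrary: h rule: less_induct)
    case less
    obtain q where q: "polyfun q" "\<And>v. h v = q v * f v"
      using divides[OF less.prems(1)] less.prems(2) Z(2) by blast
    have "vanishes_on (\<lambda>v. q v * f v) Z" using less.prems(2) q(2) by simp
    from irreducible_setD[OF Z(1) q(1) f(1) this] assms(5) have "vanishes_on q Z" by blast
    moreover have "q v \<noteq> 0" using q(2) less.prems(3) by auto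
    moreover have "degree (line_poly q v w) < degree (line_poly h v w)"
      using degree_line_poly_multiple[OF q less.prems(3) w] d_pos by simp
    ultimately show False using less.hyps q(1) by blast
  qed
qed

text \<open>Otherwise adding elements of \<open>C\<close> would preserve the zero set of
  \<open>f\<close>, which would then contain all sums and so the whole space.\<close>

lemma not_vanishing_next: "\<not> vanishes_on f (sums_of C (Suc r))"
proof
  assume van: "vanishes_on f (sums_of C (Suc r))"
  have stable: "f (x + v) = 0" if "x \<in> C" "f v = 0" for x v
    by (rule vanishes_on_zeros[OF polyfun_translate'[OF f(1)] _ that(2)])
      (use van that(1) in \<open>auto intro: sumsetI\<close>)
  have "vanishes_on f (sums_of C k)" for k
    by (induction k) (auto simp: f_zero sumset_def stable)
  then have "f v = 0" for v using exists_sum[of v] by blast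
  then show False using f(4) by blast
qed

lemma dense_next:
  assumes "polyfun h" "vanishes_on h (sums_of C (Suc r))"
  shows "h v = 0"
  by (rule dense_overset[OF irr_sums _ assms not_vanishing_next]) (rule sums_of_mono[OF zero_mem], simp)

lemma open_next:
  obtains g where "polyfun g" "\<exists>v. g v \<noteq> 0" "\<forall>v. g v \<noteq> 0 \<longrightarrow> v \<in> sums_of C (Suc r)"
proof -
  obtain g where g: "polyfun g" "\<not> vanishes_on g (sums_of C (Suc r))"
    "\<forall>v\<in>zariski_closure (sums_of C (Suc r)). g v \<noteq> 0 \<longrightarrow> v \<in> sums_of C (Suc r)"
    using open_sums unfolding contains_open_def by blast
  moreover have "v \<in> zariski_closure (sums_of C (Suc r))" for v
    using dense_next by (simp add: zariski_closure_def)
  ultimately show ?thesis by (intro that[of g]) auto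
qed

lemma open_zeros:
  obtains g where "polyfun g" "\<not> vanishes_on g (sums_of C r)"
    "\<forall>v. f v = 0 \<longrightarrow> g v \<noteq> 0 \<longrightarrow> v \<in> sums_of C r"
proof -
  obtain g where "polyfun g" "\<not> vanishes_on g (sums_of C r)"
    "\<forall>v\<in>zariski_closure (sums_of C r). g v \<noteq> 0 \<longrightarrow> v \<in> sums_of C r"
    using open_sums unfolding contains_open_def by blast
  then show ?thesis using closure_iff by (intro that[of g]) auto
qed

lemma combination_mem:
  assumes "x \<in> sums_of C k" "y \<in> sums_of C l" "q = a *s x + b *s y"
  shows "q \<in> sums_of C (k + l)"
  unfolding assms(3) by (intro sums_of_add sums_of_scale[OF cone] assms(1,2))

section \<open>Writing a vector as a combination of two points on a line\<close>

text \<open>Translation along \<open>q\<close> preserves the zero set of \<open>f\<close>, so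
  \<open>s\<close> and \<open>s + q\<close> can be generic at the same time.\<close>

lemma vertex_mem:
  assumes "\<forall>s\<in>sums_of C r. \<forall>t. f (s + t *s q) = 0"
  shows "q \<in> sums_of C (2 * r)"
proof -
  obtain g where g: "polyfun g" "\<not> vanishes_on g (sums_of C r)"
    "\<forall>v. f v = 0 \<longrightarrow> g v \<noteq> 0 \<longrightarrow> v \<in> sums_of C r" by (rule open_zeros)
  \<comment> \<open>If it vanished, it would vanish on all zeros of \<open>f\<close>, in particular
    at \<open>s - q\<close>, where its value is \<open>g s\<close>.\<close>
  have "\<not> vanishes_on (\<lambda>v. g (v + q)) (sums_of C r)"
  proof
    assume van: "vanishes_on (\<lambda>v. g (v + q)) (sums_of C r)"
    have "g s = 0" if "s \<in> sums_of C r" for s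
    proof -
      have "f (s + (-1) *s q) = 0" using assms that by blast
      then have "g (s + (-1) *s q + q) = 0"
        by (rule vanishes_on_zeros[OF polyfun_translate[OF g(1)] van])
      then show ?thesis by simp
    qed
    then show False using g(2) by blast
  qed
  from irreducible_set_mult[OF irr_sums g(1) polyfun_translate[OF g(1)] g(2) this]
  obtain s where s: "s \<in> sums_of C r" "g (s + q) \<noteq> 0" by auto
  have "f (s + 1 *s q) = 0" using assms s(1) by blast
  then have "s + q \<in> sums_of C r" using g(3) s(2) by simp
  from combination_mem[OF this s(1), of q 1 "-1"] show ?thesis by (simp add: mult_2)
qed

lemma not_vertex_line:
  assumes "s \<in> sums_of C r" "f (s + t *s q) \<noteq> 0" "polyfun h" "h v \<noteq> 0"
  shows "\<not> vanishes_on h (sumset (sums_of C r) (line_through q))"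
proof
  assume van: "vanishes_on h (sumset (sums_of C r) (line_through q))"
  have "h v = 0"
  proof (rule dense_overset[OF _ _ assms(3) van])
    show "irreducible_set (sumset (sums_of C r) (line_through q))"
      by (intro irreducible_set_sumset irr_sums irreducible_set_line)
    show "sums_of C r \<subseteq> sumset (sums_of C r) (line_through q)"
    proof
      fix x assume "x \<in> sums_of C r"
      then show "x \<in> sumset (sums_of C r) (line_through q)"
        using sumsetI[OF _ rangeI, of x _ "\<lambda>t. t *s q" 0] by simp
    qed
    show "\<not> vanishes_on f (sumset (sums_of C r) (line_through q))"
      using assms(1,2) sumsetI[OF assms(1) rangeI, of "\<lambda>t. t *s q" t] by blast
  qed
  then show False using assms(4) by blast
qed

theorem mem_sums_odd: "q \<in> sums_of C (2 * r + 1)"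
proof (cases "\<forall>s\<in>sums_of C r. \<forall>t. f (s + t *s q) = 0")
  case True
  then have "q \<in> sums_of C (2 * r)" by (rule vertex_mem)
  then show ?thesis using sums_of_mono[OF zero_mem, of "2 * r" "2 * r + 1"] by auto
next
  case False
  then obtain s0 t0 where st: "s0 \<in> sums_of C r" "f (s0 + t0 *s q) \<noteq> 0" by blast
  obtain g where g: "polyfun g" "\<exists>v. g v \<noteq> 0" "\<forall>v. g v \<noteq> 0 \<longrightarrow> v \<in> sums_of C (Suc r)"
    by (rule open_next)
  then obtain v where "g v \<noteq> 0" by blast
  from not_vertex_line[OF st g(1) this] obtain s t1 where s: "s \<in> sums_of C r" "g (s + t1 *s q) \<noteq> 0"
    by (auto simp: sumset_def)
  then have "line_poly g s q \<noteq> 0" using poly_line_poly[OF g(1), of s q t1] by auto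
  \<comment> \<open>The extra factor excludes the parameter 0, so that the equation can be solved
    for \<open>q\<close>.\<close>
  then have "[:0, 1:] * line_poly g s q \<noteq> 0" by simp
  then obtain t where "poly ([:0, 1:] * line_poly g s q) t \<noteq> 0"
    by (metis poly_eq_poly_eq_iff poly_0 ext)
  then have t: "t \<noteq> 0" "g (s + t *s q) \<noteq> 0" using g(1) by (auto simp: poly_line_poly)
  have "q = inverse t *s (s + t *s q) + (- inverse t) *s s"
    using t(1) by (simp add: vec_eq_iff field_simps)
  from combination_mem[OF g(3)[rule_format, OF t(2)] s(1) this] show ?thesis by (simp add: mult_2)
qed

text \<open>The coefficient of the \<open>k\<close>-th power of \<open>t\<close> in
  \<open>f (v + t *s q)\<close> is, as a function of \<open>v\<close>, the part of degree
  \<open>d - k\<close> of the Taylor expansion of \<open>f\<close> at \<open>q\<close>. Largest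
  degree \<open>e\<close> in \<open>t\<close> thus means multiplicity \<open>d - e\<close> at
  \<open>q\<close>: the hypothesis excludes \<open>e = 1\<close>, and a line not contained in the
  hypersurface excludes \<open>e = 0\<close>.\<close>

theorem mem_sums_even:
  assumes "\<nexists>f1. polyfun f1 \<and> homog (d - 1) f1 \<and> (\<exists>v. f1 v \<noteq> 0) \<and> (\<forall>x. f (q + x) = f x + f1 x)"
  shows "q \<in> sums_of C (2 * r)"
proof (cases "\<forall>s\<in>sums_of C r. \<forall>t. f (s + t *s q) = 0")
  case False
  then obtain s0 t0 where st: "s0 \<in> sums_of C r" "f (s0 + t0 *s q) \<noteq> 0" by blast
  define c where "c k v = coeff (line_poly f v q) k" for k v
  have pol: "polyfun (c k)" for k
    unfolding c_def[abs_def] by (rule polyfun_coeff_line_poly[OF f(1)]) (auto intro: polyfun_intros)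
  have hom: "homog (d - k) (c k)" if "k \<le> d" for k
    unfolding c_def[abs_def] by (rule homog_line_poly_coeff[OF f(1,2) that])
  have c0: "c 0 v = f v" for v
    using poly_line_poly[OF f(1), of v q 0] by (simp add: c_def poly_0_coeff_0)
  have gen: "\<not> vanishes_on (c k) (sums_of C r)" if "k \<le> d" "k \<ge> 1" "c k v \<noteq> 0" for k v
    using minimal[OF pol hom[OF that(1)], of v] that by fastforce
  define J where "J = {k. k \<le> d \<and> (\<exists>v. c k v \<noteq> 0)}"
  have finJ: "finite J" by (simp add: J_def)
  have "0 \<in> J" using f(4) by (auto simp: J_def c0)
  define e where "e = Max J"
  have e: "e \<in> J" unfolding e_def by (rule Max_in[OF finJ]) (use \<open>0 \<in> J\<close> in auto)
  then have "e \<le> d" by (simp add: J_def)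
  have above: "c k v = 0" if "k > e" for k v
  proof (cases "k \<le> d")
    case True
    have "k \<notin> J" using Max_ge[OF finJ, of k] that by (auto simp: e_def)
    then show ?thesis using True by (auto simp: J_def)
  next
    case False
    then show ?thesis using line_poly_homog(2)[OF f(1,2), of v q] by (simp add: c_def coeff_eq_0)
  qed
  have deg: "degree (line_poly f v q) \<le> e" for v
    by (rule degree_le) (use above in \<open>auto simp: c_def\<close>)
  have "e \<noteq> 0"
  proof
    assume "e = 0"
    then have "line_poly f s0 q = [:c 0 s0:]"
      using deg[of s0] by (auto simp: c_def elim: degree_eq_zeroE)
    then have "f (s0 + t0 *s q) = c 0 s0" using poly_line_poly[OF f(1), of s0 q t0] by simp
    then show False using st f(3) c0 by simp
  qed
  moreover have "e \<noteq> 1"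
  proof
    assume e1: "e = 1"
    have "f (q + x) = f x + c 1 x" for x
    proof -
      have "degree (line_poly f x q) \<le> 1" using deg e1 by simp
      then have "poly (line_poly f x q) 1 = (\<Sum>k\<le>1. c k x * 1 ^ k)"
        unfolding c_def by (rule poly_eq_sum_bound)
      then show ?thesis using f(1) c0 by (simp add: poly_line_poly add.commute)
    qed
    moreover have "\<exists>v. c 1 v \<noteq> 0" using e e1 by (simp add: J_def)
    ultimately show False using assms pol[of 1] hom[of 1] d_pos by auto
  qed
  ultimately have e2: "e \<ge> 2" by simp
  \<comment> \<open>\<open>c 1\<close> is the derivative along \<open>q\<close>. If it vanished
    everywhere, \<open>f\<close> would be constant along \<open>q\<close> in characteristic zero,
    against \<open>e \<ge> 2\<close>.\<close>
  have "\<exists>v. c 1 v \<noteq> 0"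
  proof (rule ccontr)
    assume no: "\<nexists>v. c 1 v \<noteq> 0"
    have "pderiv (line_poly f v q) = 0" for v
      unfolding poly_eq_poly_eq_iff[symmetric]
    proof
      fix t
      have "line_poly f (v + t *s q) q = pcompose (line_poly f v q) [:t, 1:]"
        by (rule line_poly_unique[OF f(1)])
          (use f(1) in \<open>simp add: poly_pcompose poly_line_poly vec.scale_left_distrib add_ac\<close>)
      then have "coeff (pcompose (line_poly f v q) [:t, 1:]) 1 = c 1 (v + t *s q)"
        by (simp only: c_def)
      then have "coeff (pcompose (line_poly f v q) [:t, 1:]) 1 = 0"
        using no by simp
      moreover have "coeff p 1 = poly (pderiv p) 0" for p :: "'a poly"
        by (simp add: poly_0_coeff_0 coeff_pderiv)
      ultimately have "poly (pderiv (pcompose (line_poly f v q) [:t, 1:])) 0 = 0" by metis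
      then show "poly (pderiv (line_poly f v q)) t = poly 0 t"
        by (simp add: pderiv_pcompose poly_pcompose pderiv_pCons)
    qed
    then have "degree (line_poly f v q) = 0" for v by (simp add: pderiv_eq_0_iff)
    moreover obtain v where "c e v \<noteq> 0" using e by (auto simp: J_def)
    ultimately show False using e2 le_degree[of "line_poly f v q" e] by (simp add: c_def)
  qed
  then have c1: "\<not> vanishes_on (c 1) (sums_of C r)" using gen[of 1] d_pos by auto
  have ce: "\<not> vanishes_on (c e) (sums_of C r)" using gen[of e] e e2 by (auto simp: J_def)
  obtain g where g: "polyfun g" "\<not> vanishes_on g (sums_of C r)"
    "\<forall>v. f v = 0 \<longrightarrow> g v \<noteq> 0 \<longrightarrow> v \<in> sums_of C r" by (rule open_zeros)
  have "q \<noteq> 0" using st f(3) by auto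
  then obtain lam where dir: "direction q lam" using direction_exists by blast
  \<comment> \<open>Allows the condition on the still unknown root to be imposed at
    \<open>s\<close>.\<close>
  obtain h where h: "polyfun h" "direction.winv q h" "\<not> vanishes_on h (sums_of C r)"
    "\<forall>z\<in>zariski_closure (sums_of C r). h z \<noteq> 0 \<longrightarrow> g z \<noteq> 0"
    by (rule direction.invariant_multiple[OF dir irr_sums f(1,3) st g(1,2)])
  have "\<not> vanishes_on (\<lambda>v. c 1 v * (c e v * h v)) (sums_of C r)"
    by (intro irreducible_set_mult[OF irr_sums] polyfun.mult pol h c1 ce)
  then obtain s where s: "s \<in> sums_of C r" "c 1 s \<noteq> 0" "c e s \<noteq> 0" "h s \<noteq> 0" by auto
  \<comment> \<open>Removing the root 0 leaves \<open>Q\<close> of positive degree, and its value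
    \<open>c 1 s\<close> at 0 is nonzero; hence it has a nonzero root.\<close>
  obtain a Q where Q: "line_poly f s q = pCons a Q" by (cases "line_poly f s q")
  have "a = 0" using c0[of s] f(3) s(1) by (simp add: c_def Q)
  have "degree (line_poly f s q) \<ge> e" by (rule le_degree) (use s(3) in \<open>simp add: c_def\<close>)
  then have "degree Q > 0" using e2 unfolding Q by (auto split: if_splits)
  then obtain t where t: "poly Q t = 0" using alg_closed_imp_poly_has_root by blast
  have "t \<noteq> 0"
  proof
    assume "t = 0"
    then have "c 1 s = 0" using t by (simp add: c_def Q poly_0_coeff_0)
    then show False using s(2) by blast
  qed
  have ft: "f (s + t *s q) = 0"
    using poly_line_poly[OF f(1), of s q t] by (simp add: Q \<open>a = 0\<close> t)
  have "h (s + t *s q) = h s" using h(2) unfolding direction.winv_def[OF dir] by blast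
  then have "g (s + t *s q) \<noteq> 0" using h(4) s(4) ft closure_iff by auto
  then have mem: "s + t *s q \<in> sums_of C r" using g(3) ft by blast
  have "q = inverse t *s (s + t *s q) + (- inverse t) *s s"
    using \<open>t \<noteq> 0\<close> by (simp add: vec_eq_iff field_simps)
  from combination_mem[OF mem s(1) this] show ?thesis by (simp add: mult_2)
qed (rule vertex_mem)

end


section \<open>Polynomials and polynomial functions\<close>

lemma sum_single_keys: "(\<Sum>m\<in>Poly_Mapping.keys F. Poly_Mapping.single m (Poly_Mapping.lookup F m)) = F"
proof (rule poly_mapping_eqI)
  fix k
  show "Poly_Mapping.lookup (\<Sum>m\<in>Poly_Mapping.keys F. Poly_Mapping.single m (Poly_Mapping.lookup F m)) k
      = Poly_Mapping.lookup F k"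
    by (cases "k \<in> Poly_Mapping.keys F")
      (auto simp: lookup_sum lookup_single when_def in_keys_iff sum.delta' cong: if_cong)
qed

lemma mpoly_eval_eq_sum:
  assumes "finite A" "Poly_Mapping.keys F \<subseteq> A"
  shows "mpoly_eval F v =
    (\<Sum>m\<in>A. Poly_Mapping.lookup F m * (\<Prod>i\<in>UNIV. v $ i ^ Poly_Mapping.lookup m i))"
  unfolding mpoly_eval_def mpoly_subst_def
  by (rule sum.mono_neutral_left) (use assms in \<open>auto simp: in_keys_iff\<close>)

lemma mpoly_eval_zero [simp]: "mpoly_eval 0 v = 0"
  by (simp add: mpoly_eval_def mpoly_subst_def)

lemma mpoly_eval_single:
  "mpoly_eval (Poly_Mapping.single m c) v = c * (\<Prod>i\<in>UNIV. v $ i ^ Poly_Mapping.lookup m i)"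
  by (subst mpoly_eval_eq_sum[of "{m}"]) auto

lemma mpoly_eval_add: "mpoly_eval (F + G) v = mpoly_eval F v + mpoly_eval G v"
proof -
  let ?A = "Poly_Mapping.keys F \<union> Poly_Mapping.keys G"
  have "Poly_Mapping.keys (F + G) \<subseteq> ?A" by (rule keys_add)
  then show ?thesis
    by (simp add: mpoly_eval_eq_sum[of ?A] lookup_add distrib_right sum.distrib)
qed

lemma mpoly_eval_sum: "mpoly_eval (sum F A) v = (\<Sum>a\<in>A. mpoly_eval (F a) v)"
  by (induction A rule: infinite_finite_induct) (simp_all add: mpoly_eval_add)

lemma mpoly_eval_mult:
  fixes F G :: "('a::comm_semiring_1, 'b::finite) mpoly"
  shows "mpoly_eval (F * G) v = mpoly_eval F v * mpoly_eval G v"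
proof -
  have single: "mpoly_eval (Poly_Mapping.single m a * Poly_Mapping.single k b) v
      = mpoly_eval (Poly_Mapping.single m a) v * mpoly_eval (Poly_Mapping.single k b) v" for m k a b
    by (simp add: mult_single mpoly_eval_single lookup_add power_add prod.distrib mult_ac)
  have "mpoly_eval (sum S A * sum T B) v = mpoly_eval (sum S A) v * mpoly_eval (sum T B) v"
    if "\<And>a b. mpoly_eval (S a * T b) v = mpoly_eval (S a) v * mpoly_eval (T b) v" for S T
    and A B :: "('b \<Rightarrow>\<^sub>0 nat) set"
    by (simp add: sum_product mpoly_eval_sum that)
  from this[of "\<lambda>m. Poly_Mapping.single m (Poly_Mapping.lookup F m)"
      "\<lambda>m. Poly_Mapping.single m (Poly_Mapping.lookup G m)"
      "Poly_Mapping.keys F" "Poly_Mapping.keys G", OF single]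
  show ?thesis unfolding sum_single_keys .
qed

lemma mpoly_eval_const: "mpoly_eval (mpoly_const c) v = c"
  by (simp add: mpoly_const_def mpoly_eval_single)

lemma mpoly_eval_one: "mpoly_eval 1 v = 1"
  using mpoly_eval_const[of 1 v] by (simp add: mpoly_const_def)

lemma mpoly_eval_var: "mpoly_eval (mpoly_var i) v = v $ i"
proof -
  have "v $ j ^ Poly_Mapping.lookup (Poly_Mapping.single i 1) j = (if j = i then v $ j else 1)" for j
    by (simp add: lookup_single when_def)
  then show ?thesis by (simp add: mpoly_var_def mpoly_eval_single)
qed

lemma mpoly_eval_power: "mpoly_eval (F ^ k) v = mpoly_eval F v ^ k"
  by (induction k) (simp_all add: mpoly_eval_one mpoly_eval_mult)

lemma mpoly_eval_prod: "mpoly_eval (prod F A) v = (\<Prod>a\<in>A. mpoly_eval (F a) v)"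
  by (induction A rule: infinite_finite_induct) (simp_all add: mpoly_eval_one mpoly_eval_mult)

lemma mpoly_eval_taylor_shift: "mpoly_eval (taylor_shift q F) v = mpoly_eval F (q + v)"
  unfolding taylor_shift_def mpoly_subst_def mpoly_eval_sum mpoly_eval_mult mpoly_eval_prod
    mpoly_eval_power mpoly_eval_add mpoly_eval_const mpoly_eval_var
  by (simp add: mpoly_eval_def mpoly_subst_def)

lemma polyfun_mpoly_eval: "polyfun (mpoly_eval (F :: ('a::comm_ring_1, 'n::finite) mpoly))"
  unfolding mpoly_eval_def[abs_def] mpoly_subst_def by (intro polyfun_intros)

lemma polyfun_imp_mpoly:
  "polyfun f \<Longrightarrow> \<exists>F. \<forall>v. mpoly_eval F v = f (v :: 'a::comm_ring_1 ^ 'n::finite)"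
proof (induction rule: polyfun.induct)
  case (const c)
  then show ?case using mpoly_eval_const by blast
next
  case (coord i)
  then show ?case using mpoly_eval_var by blast
next
  case (add f g)
  then obtain F G where "\<forall>v. mpoly_eval F v = f v" "\<forall>v. mpoly_eval G v = g v" by blast
  then have "\<forall>v. mpoly_eval (F + G) v = f v + g v" by (simp add: mpoly_eval_add)
  then show ?case by blast
next
  case (mult f g)
  then obtain F G where "\<forall>v. mpoly_eval F v = f v" "\<forall>v. mpoly_eval G v = g v" by blast
  then have "\<forall>v. mpoly_eval (F * G) v = f v * g v" by (simp add: mpoly_eval_mult)
  then show ?case by blast
qed

text \<open>Kronecker's substitution: the new weight \<open>B\<close> exceeds all earlier weighted
  sums, so quotient and remainder modulo \<open>B\<close> recover the new exponent and the old
  sum.\<close>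

lemma separating_weights:
  fixes M :: "('n \<Rightarrow> nat) set"
  assumes "finite M" "finite S"
  shows "\<exists>W. \<forall>m\<in>M. \<forall>m'\<in>M. (\<Sum>i\<in>S. W i * m i) = (\<Sum>i\<in>S. W i * m' i) \<longrightarrow> (\<forall>i\<in>S. m i = m' i)"
  using assms(2)
proof induction
  case (insert j S)
  then obtain W where W: "\<forall>m\<in>M. \<forall>m'\<in>M. (\<Sum>i\<in>S. W i * m i) = (\<Sum>i\<in>S. W i * m' i)
      \<longrightarrow> (\<forall>i\<in>S. m i = m' i)" by blast
  obtain B where B: "\<And>m. m \<in> M \<Longrightarrow> (\<Sum>i\<in>S. W i * m i) < B"
    using finite_nat_set_iff_bounded[of "(\<lambda>m. \<Sum>i\<in>S. W i * m i) ` M"] assms(1) by auto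
  have sums: "(\<Sum>i\<in>insert j S. (W(j := B)) i * m i) = (\<Sum>i\<in>S. W i * m i) + B * m j" for m
  proof -
    have "(\<Sum>i\<in>S. (W(j := B)) i * m i) = (\<Sum>i\<in>S. W i * m i)"
      by (rule sum.cong) (use insert.hyps in auto)
    then show ?thesis using insert.hyps by simp
  qed
  show ?case
  proof (intro exI[of _ "W(j := B)"] ballI impI)
    fix m m' i
    assume m: "m \<in> M" "m' \<in> M" and i: "i \<in> insert j S"
      and eq: "(\<Sum>i\<in>insert j S. (W(j := B)) i * m i) = (\<Sum>i\<in>insert j S. (W(j := B)) i * m' i)"
    have eq': "(\<Sum>i\<in>S. W i * m i) + B * m j = (\<Sum>i\<in>S. W i * m' i) + B * m' j"
      using eq unfolding sums .
    have "m j = m' j"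
      using arg_cong[OF eq', of "\<lambda>x. x div B"] B[OF m(1)] B[OF m(2)] by simp
    moreover have "(\<Sum>i\<in>S. W i * m i) = (\<Sum>i\<in>S. W i * m' i)"
      using arg_cong[OF eq', of "\<lambda>x. x mod B"] B[OF m(1)] B[OF m(2)] by simp
    ultimately show "m i = m' i" using W m i by blast
  qed
qed simp

text \<open>
  Substituting powers of one variable, with weights separating the occurring monomials, reduces
  the identity theorem to polynomials in one variable.
\<close>

lemma mpoly_eval_eq_0_imp:
  fixes F :: "('a::{idom, ring_char_0}, 'n::finite) mpoly"
  assumes "\<And>v. mpoly_eval F v = 0"
  shows "F = 0"
proof (rule ccontr)
  assume "F \<noteq> 0"
  let ?K = "Poly_Mapping.keys F"
  have "finite (Poly_Mapping.lookup ` ?K)" by simp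
  from separating_weights[OF this, of UNIV] obtain W :: "'n \<Rightarrow> nat" where
    W: "\<forall>m\<in>Poly_Mapping.lookup ` ?K. \<forall>m'\<in>Poly_Mapping.lookup ` ?K.
      (\<Sum>i\<in>UNIV. W i * m i) = (\<Sum>i\<in>UNIV. W i * m' i) \<longrightarrow> (\<forall>i\<in>UNIV. m i = m' i)"
    by auto
  define N where "N m = (\<Sum>i\<in>UNIV. W i * Poly_Mapping.lookup m i)" for m
  have inj: "inj_on N ?K"
  proof (rule inj_onI)
    fix m m' assume m: "m \<in> ?K" "m' \<in> ?K" "N m = N m'"
    then have "\<forall>i\<in>UNIV. Poly_Mapping.lookup m i = Poly_Mapping.lookup m' i"
      using W unfolding N_def by blast
    then show "m = m'" by (intro poly_mapping_eqI) simp
  qed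
  define P where "P = (\<Sum>m\<in>?K. monom (Poly_Mapping.lookup F m) (N m))"
  have "poly P x = mpoly_eval F (\<chi> i. x ^ W i)" for x
    unfolding P_def mpoly_eval_def mpoly_subst_def N_def
    by (simp add: poly_sum poly_monom power_sum power_mult)
  then have "P = 0" using assms by (simp add: poly_eq_poly_eq_iff[symmetric] fun_eq_iff)
  obtain m where m: "m \<in> ?K" using \<open>F \<noteq> 0\<close> by fastforce
  have "coeff P (N m) = (\<Sum>m'\<in>?K. if m' = m then Poly_Mapping.lookup F m' else 0)"
    unfolding P_def coeff_sum
    by (rule sum.cong) (use inj m in \<open>auto simp: coeff_monom inj_on_def\<close>)
  then have "Poly_Mapping.lookup F m = 0" using \<open>P = 0\<close> m by simp
  then show False using m by (simp add: in_keys_iff)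
qed

lemma mpoly_eqI:
  fixes F G :: "('a::{idom, ring_char_0}, 'n::finite) mpoly"
  assumes "\<And>v. mpoly_eval F v = mpoly_eval G v"
  shows "F = G"
proof -
  have "mpoly_eval (F - G) v = 0" for v
    using mpoly_eval_add[of "F - G" G v] assms[of v] by simp
  then have "F - G = 0" by (rule mpoly_eval_eq_0_imp)
  then show ?thesis by simp
qed

lemma homog_mpoly_eval:
  fixes F :: "('a::{idom, ring_char_0}, 'n::finite) mpoly"
  shows "homog d (mpoly_eval F) \<longleftrightarrow> homogeneous_mpoly d F"
proof
  have scale: "(\<Prod>i\<in>UNIV. (c *s v) $ i ^ Poly_Mapping.lookup m i)
    = c ^ monom_degree m * (\<Prod>i\<in>UNIV. v $ i ^ Poly_Mapping.lookup m i)" for c :: 'a and v :: "'a ^ 'n" and m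
    by (simp add: power_mult_distrib prod.distrib power_sum monom_degree_def)
  {
    assume "homogeneous_mpoly d F"
    then show "homog d (mpoly_eval F)"
      unfolding homog_def mpoly_eval_def mpoly_subst_def scale homogeneous_mpoly_def
      by (auto simp: sum_distrib_left mult_ac intro!: sum.cong)
  next
    assume hom: "homog d (mpoly_eval F)"
    \<comment> \<open>Its value is that of \<open>F\<close> at \<open>2 *s v\<close> minus
      \<open>2 ^ d\<close> times that at \<open>v\<close>, hence zero. In characteristic zero
      different degrees give different powers of 2.\<close>
    define G where "G = (\<Sum>m\<in>Poly_Mapping.keys F.
      Poly_Mapping.single m (Poly_Mapping.lookup F m * (2 ^ monom_degree m - 2 ^ d)))"
    have "mpoly_eval G v = mpoly_eval F (2 *s v) - 2 ^ d * mpoly_eval F v" for v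
      unfolding G_def mpoly_eval_sum mpoly_eval_single mpoly_eval_eq_sum[OF finite_keys subset_refl, of F] scale
      by (simp add: sum_distrib_left right_diff_distrib left_diff_distrib sum_subtractf mult_ac)
    then have "G = 0" using hom by (intro mpoly_eval_eq_0_imp) (simp add: homog_def)
    show "homogeneous_mpoly d F"
      unfolding homogeneous_mpoly_def
    proof
      fix m assume m: "m \<in> Poly_Mapping.keys F"
      have "Poly_Mapping.lookup G m = Poly_Mapping.lookup F m * (2 ^ monom_degree m - 2 ^ d)"
        using m by (simp add: G_def lookup_sum lookup_single when_def)
      then have "(2::'a) ^ monom_degree m = 2 ^ d"
        using m \<open>G = 0\<close> by (simp add: in_keys_iff)
      then have "of_nat (2 ^ monom_degree m) = (of_nat (2 ^ d) :: 'a)" by simp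
      then have "(2::nat) ^ monom_degree m = 2 ^ d" by (subst (asm) of_nat_eq_iff)
      then show "monom_degree m = d" by simp
    qed
  }
qed

lemma degrees_homogeneous:
  assumes "homogeneous_mpoly d F" "F \<noteq> 0"
  shows "monom_degree ` Poly_Mapping.keys F = {d}"
proof -
  have "Poly_Mapping.keys F \<noteq> {}" using assms(2) by simp
  then show ?thesis using assms(1) unfolding homogeneous_mpoly_def by fastforce
qed

lemma mpoly_degree_homogeneous:
  assumes "homogeneous_mpoly d F" "F \<noteq> 0"
  shows "mpoly_degree F = d"
proof -
  have "monom_degree ` Poly_Mapping.keys F = {d}"
    by (rule degrees_homogeneous) fact+
  then show ?thesis by (simp add: mpoly_degree_def)
qed

text \<open>Forms of different degrees share no monomials, so nothing cancels in the Taylor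
  expansion.\<close>

lemma vanishing_order_two_terms:
  fixes F F1 :: "('a::{idom, ring_char_0}, 'n::finite) mpoly"
  assumes "homogeneous_mpoly d F" "homogeneous_mpoly (d - 1) F1" "F \<noteq> 0" "F1 \<noteq> 0" "d \<ge> 1"
    and "\<And>x. mpoly_eval F (q + x) = mpoly_eval F x + mpoly_eval F1 x"
  shows "vanishing_order F q = d - 1"
proof -
  have shift: "taylor_shift q F = F + F1"
    by (rule mpoly_eqI) (simp add: mpoly_eval_taylor_shift mpoly_eval_add assms(6))
  have disj: "Poly_Mapping.lookup F m = 0 \<or> Poly_Mapping.lookup F1 m = 0" for m
  proof (rule ccontr)
    assume "\<not> ?thesis"
    then have "m \<in> Poly_Mapping.keys F" "m \<in> Poly_Mapping.keys F1" by (auto simp: in_keys_iff)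
    then have "monom_degree m = d" "monom_degree m = d - 1"
      using assms(1,2) by (auto simp: homogeneous_mpoly_def)
    then show False using assms(5) by simp
  qed
  have "Poly_Mapping.keys (F + F1) = Poly_Mapping.keys F \<union> Poly_Mapping.keys F1"
  proof (rule set_eqI)
    fix m
    show "m \<in> Poly_Mapping.keys (F + F1) \<longleftrightarrow> m \<in> Poly_Mapping.keys F \<union> Poly_Mapping.keys F1"
      using disj[of m] by (auto simp: in_keys_iff lookup_add)
  qed
  moreover have "monom_degree ` Poly_Mapping.keys F = {d}" "monom_degree ` Poly_Mapping.keys F1 = {d - 1}"
    using degrees_homogeneous assms(1-4) by blast+
  ultimately have "monom_degree ` Poly_Mapping.keys (taylor_shift q F) = {d, d - 1}"
    by (auto simp: shift image_Un)
  then show ?thesis by (simp add: vanishing_order_def)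
qed


section \<open>Projective varieties and their cones\<close>

lemma span_eq_of_mem:
  fixes p :: "('a::field ^ 'n::finite) set"
  assumes "p \<in> projective_space" "v \<in> p" "v \<noteq> 0"
  shows "p = vec.span {v}"
proof -
  obtain u where u: "p = vec.span {u}" using assms(1) by (auto simp: projective_space_def)
  then obtain c where c: "v = c *s u" using assms(2) by (auto simp: vec.span_singleton)
  then have "c \<noteq> 0" using assms(3) by auto
  then have "u = inverse c *s v" using c by simp
  then have "u \<in> vec.span {v}" by (metis vec.span_scale vec.span_base singletonI)
  moreover have "v \<in> vec.span {u}" using assms(2) u by simp
  ultimately show ?thesis unfolding u by (intro antisym vec.span_minimal vec.subspace_span) auto
qed

lemma span_mem_projective_space: "v \<noteq> 0 \<Longrightarrow> vec.span {v} \<in> projective_space"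
  by (auto simp: projective_space_def)

lemma mem_affine_cone_iff:
  assumes "X \<subseteq> projective_space" "v \<noteq> 0"
  shows "v \<in> affine_cone X \<longleftrightarrow> vec.span {v} \<in> X"
proof
  assume "v \<in> affine_cone X"
  then obtain p where p: "p \<in> X" "v \<in> p" using assms(2) by (auto simp: affine_cone_def)
  then have "p = vec.span {v}" using span_eq_of_mem assms by blast
  then show "vec.span {v} \<in> X" using p by simp
next
  assume "vec.span {v} \<in> X"
  moreover have "v \<in> vec.span {v}" by (simp add: vec.span_base)
  ultimately show "v \<in> affine_cone X" by (auto simp: affine_cone_def)
qed

lemma projective_zeros_subset: "projective_zeros S \<subseteq> projective_space"
  by (auto simp: projective_zeros_def)

lemma homogeneous_eval_scale:
  "homogeneous_mpoly d (F :: ('a::{idom, ring_char_0}, 'n::finite) mpoly) \<Longrightarrow>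
    mpoly_eval F (c *s v) = c ^ d * mpoly_eval F v"
  using homog_mpoly_eval[of d F] by (simp add: homog_def)

lemma homogeneous_eval_zero:
  "homogeneous_mpoly d (F :: ('a::{idom, ring_char_0}, 'n::finite) mpoly) \<Longrightarrow> d \<ge> 1 \<Longrightarrow>
    mpoly_eval F 0 = 0"
  using homogeneous_eval_scale[of d F 0 0] by (simp add: power_0_left split: if_splits)

lemma span_mem_projective_zeros:
  fixes S :: "('a::field_char_0, 'n::finite) mpoly set"
  assumes S: "\<forall>F\<in>S. \<exists>d. homogeneous_mpoly d F" and v: "v \<noteq> 0"
  shows "vec.span {v} \<in> projective_zeros S \<longleftrightarrow> (\<forall>F\<in>S. mpoly_eval F v = 0)"
proof
  assume "vec.span {v} \<in> projective_zeros S"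
  moreover have "v \<in> vec.span {v}" by (simp add: vec.span_base)
  ultimately show "\<forall>F\<in>S. mpoly_eval F v = 0" using v by (auto simp: projective_zeros_def)
next
  assume zero: "\<forall>F\<in>S. mpoly_eval F v = 0"
  have "mpoly_eval F x = 0" if F: "F \<in> S" and x: "x \<in> vec.span {v}" for F x
  proof -
    obtain c where "x = c *s v" using x by (auto simp: vec.span_singleton)
    moreover obtain d where "homogeneous_mpoly d F" using S F by blast
    ultimately show ?thesis using zero F homogeneous_eval_scale by fastforce
  qed
  then show "vec.span {v} \<in> projective_zeros S"
    using span_mem_projective_space[OF v] by (auto simp: projective_zeros_def)
qed

lemma projective_closed_single:
  "homogeneous_mpoly d F \<Longrightarrow> projective_closed (projective_zeros {F})"
  unfolding projective_closed_def by blast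

lemma homog_comp_mpoly:
  fixes f :: "'a::{idom, ring_char_0} ^ 'n::finite \<Rightarrow> 'a"
  assumes "polyfun f"
  obtains F where "homogeneous_mpoly j F" "\<forall>v. mpoly_eval F v = homog_comp j f v"
proof -
  obtain F where F: "\<forall>v. mpoly_eval F v = homog_comp j f v"
    using polyfun_imp_mpoly[OF polyfun_homog_comp[OF assms]] by blast
  then have "mpoly_eval F = homog_comp j f" by blast
  then have "homogeneous_mpoly j F"
    using homog_homog_comp[OF assms, of j] homog_mpoly_eval[of j F] by simp
  then show ?thesis using F that by blast
qed

lemma homog_comp_eq_0:
  fixes f :: "'a::{idom, ring_char_0} ^ 'n \<Rightarrow> 'a"
  assumes "polyfun f" "\<And>c. f (c *s v) = 0"
  shows "homog_comp j f v = 0"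
proof -
  have "line_poly f 0 v = 0" by (rule line_poly_unique[OF assms(1)]) (simp add: assms(2))
  then show ?thesis by (simp add: homog_comp_def)
qed

context
  fixes X :: "('a::{alg_closed_field, field_char_0} ^ 'n::finite) set set"
  assumes var: "irreducible_projective_variety X"
begin

lemma variety_subset: "X \<subseteq> projective_space"
  using var projective_zeros_subset
  by (auto simp: irreducible_projective_variety_def projective_closed_def)

text \<open>Projective irreducibility speaks only of forms. A function nonzero at a point has a
  component nonzero there; and on the line through 0 and a point of the cone one of the two
  restrictions is the zero polynomial, with all its coefficients.\<close>

lemma irreducible_affine_cone: "irreducible_set (affine_cone X)"
  unfolding irreducible_set_def
proof (intro conjI allI impI)
  show "affine_cone X \<noteq> {}" by (simp add: affine_cone_def)
  fix f g assume f: "polyfun f" and g: "polyfun g"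
    and fg: "vanishes_on (\<lambda>z. f z * g z) (affine_cone X)"
  show "vanishes_on f (affine_cone X) \<or> vanishes_on g (affine_cone X)"
  proof (rule ccontr)
    assume "\<not> ?thesis"
    then obtain x y where x: "x \<in> affine_cone X" "f x \<noteq> 0" and y: "y \<in> affine_cone X" "g y \<noteq> 0"
      by blast
    have comp: "\<exists>j. homog_comp j h z \<noteq> 0" if h: "polyfun h" "h z \<noteq> 0" for h :: "'a ^ 'n \<Rightarrow> 'a" and z
    proof (rule ccontr)
      assume none: "\<not> ?thesis"
      obtain D where "h z = (\<Sum>j\<le>D. homog_comp j h z)" using homog_comp_sum[OF h(1)] by blast
      then show False using none h(2) by simp
    qed
    obtain j where j: "homog_comp j f x \<noteq> 0" using comp[OF f x(2)] by blast
    obtain k where k: "homog_comp k g y \<noteq> 0" using comp[OF g y(2)] by blast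
    obtain F where F: "homogeneous_mpoly j F" "\<forall>v. mpoly_eval F v = homog_comp j f v"
      by (rule homog_comp_mpoly[OF f])
    obtain G where G: "homogeneous_mpoly k G" "\<forall>v. mpoly_eval G v = homog_comp k g v"
      by (rule homog_comp_mpoly[OF g])
    have prod: "homog_comp j f z = 0 \<or> homog_comp k g z = 0" if "z \<in> affine_cone X" for z
    proof -
      have "line_poly f 0 z * line_poly g 0 z = 0"
        unfolding poly_eq_poly_eq_iff[symmetric]
        using fg affine_cone_scale[OF variety_subset that] f g by (auto simp: poly_line_poly)
      then show ?thesis by (auto simp: homog_comp_def)
    qed
    obtain p where p: "p \<in> X" using var by (auto simp: irreducible_projective_variety_def)
    obtain u where u: "u \<noteq> 0" "p = vec.span {u}"
      using variety_subset p by (auto simp: projective_space_def)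
    have "X \<subseteq> projective_zeros {F} \<union> projective_zeros {G}"
    proof
      fix p assume p: "p \<in> X"
      then obtain u where u: "u \<noteq> 0" "p = vec.span {u}"
        using variety_subset by (auto simp: projective_space_def)
      then have "u \<in> affine_cone X" using mem_affine_cone_iff[OF variety_subset] p by blast
      from prod[OF this] have "mpoly_eval F u = 0 \<or> mpoly_eval G u = 0" using F G by simp
      then show "p \<in> projective_zeros {F} \<union> projective_zeros {G}"
        unfolding u(2) using span_mem_projective_zeros[of "{F}" u] span_mem_projective_zeros[of "{G}" u]
          F(1) G(1) u(1) by auto
    qed
    then have "X \<subseteq> projective_zeros {F} \<or> X \<subseteq> projective_zeros {G}"
      using var projective_closed_single[OF F(1)] projective_closed_single[OF G(1)]
      unfolding irreducible_projective_variety_def by blast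
    moreover have "\<not> X \<subseteq> projective_zeros {H}"
      if H: "homogeneous_mpoly i H" and z: "z \<in> affine_cone X" "mpoly_eval H z \<noteq> 0" for H i z
    proof
      assume sub: "X \<subseteq> projective_zeros {H}"
      have zero: "mpoly_eval H v = 0" if "v \<noteq> 0" "v \<in> affine_cone X" for v
        using that sub span_mem_projective_zeros[of "{H}" v] H
          mem_affine_cone_iff[OF variety_subset that(1)] by auto
      \<comment> \<open>The apex needs its own argument, since \<open>H\<close> might be constant:
        scaling \<open>u\<close> by 0 makes the value at 0 a multiple of the zero value at
        \<open>u\<close>.\<close>
      have "u \<in> affine_cone X" using mem_affine_cone_iff[OF variety_subset u(1)] u(2) p by simp
      then have "mpoly_eval H u = 0" using zero u(1) by blast
      then have "mpoly_eval H 0 = 0" using homogeneous_eval_scale[OF H, of 0 u] by simp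
      then show False using zero z by (cases "z = 0") auto
    qed
    ultimately show False using F G x(1) y(1) j k by metis
  qed
qed

lemma closed_affine_cone: "zariski_closure (affine_cone X) \<subseteq> affine_cone X"
proof
  fix v assume v: "v \<in> zariski_closure (affine_cone X)"
  show "v \<in> affine_cone X"
  proof (cases "v = 0")
    case False
    obtain S where S: "\<forall>F\<in>S. \<exists>d. homogeneous_mpoly d F" "X = projective_zeros S"
      using var by (auto simp: irreducible_projective_variety_def projective_closed_def)
    obtain p where p: "p \<in> X" using var by (auto simp: irreducible_projective_variety_def)
    then obtain u where u: "u \<noteq> 0" "p = vec.span {u}"
      using variety_subset by (auto simp: projective_space_def)
    have "mpoly_eval F v = 0" if F: "F \<in> S" for F
    proof (rule zariski_closureD[OF v polyfun_mpoly_eval], rule ballI)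
      fix z assume z: "z \<in> affine_cone X"
      obtain d where d: "homogeneous_mpoly d F" using S(1) F by blast
      have zero: "mpoly_eval F x = 0" if "x \<noteq> 0" "vec.span {x} \<in> X" for x
        using span_mem_projective_zeros[OF S(1) that(1)] that(2) S(2) F by blast
      show "mpoly_eval F z = 0"
      proof (cases "z = 0")
        case True
        have "mpoly_eval F u = 0" using zero u p by simp
        then show ?thesis using homogeneous_eval_scale[OF d, of 0 u] True by simp
      next
        case False
        then show ?thesis using zero z mem_affine_cone_iff[OF variety_subset] by blast
      qed
    qed
    then have "vec.span {v} \<in> X" using span_mem_projective_zeros[OF S(1) False] S(2) by blast
    then show ?thesis using mem_affine_cone_iff[OF variety_subset False] by blast
  qed (simp add: affine_cone_def)
qed

lemma nondegenerate_affine_cone: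
  assumes "nondegenerate X"
  shows "nondegenerate_cone (affine_cone X)"
proof (rule nondegenerate_cone.intro)
  show "irreducible_set (affine_cone X)" by (rule irreducible_affine_cone)
  show "zariski_closure (affine_cone X) \<subseteq> affine_cone X" by (rule closed_affine_cone)
  show "c *s x \<in> affine_cone X" if "x \<in> affine_cone X" for c x
    using affine_cone_scale[OF variety_subset that] .
  fix a :: "'a ^ 'n" assume a: "a \<noteq> 0"
  show "\<exists>x\<in>affine_cone X. (\<Sum>i\<in>UNIV. a $ i * x $ i) \<noteq> 0"
  proof (rule ccontr)
    assume none: "\<not> ?thesis"
    define H where "H = {p \<in> projective_space. \<forall>v\<in>p. (\<Sum>i\<in>UNIV. a $ i * v $ i) = 0}"
    have "X \<subseteq> H"
    proof
      fix p assume p: "p \<in> X"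
      then have "p \<subseteq> affine_cone X" by (auto simp: affine_cone_def)
      then show "p \<in> H" using none p variety_subset by (auto simp: H_def)
    qed
    moreover have "projective_hyperplane H"
      unfolding projective_hyperplane_def H_def using a by blast
    ultimately show False using assms by (auto simp: nondegenerate_def)
  qed
qed

end

section \<open>Ranks and secant varieties in terms of sums\<close>

lemma mem_sums_of_iff:
  "v \<in> sums_of C k \<longleftrightarrow> (\<exists>xs. length xs = k \<and> set xs \<subseteq> C \<and> v = sum_list xs)"
proof (induction k arbitrary: v)
  case (Suc k)
  show ?case
  proof
    assume "v \<in> sums_of C (Suc k)"
    then obtain x y where "x \<in> C" "y \<in> sums_of C k" "v = x + y" by (auto simp: sumset_def)
    moreover from this Suc obtain xs where "length xs = k" "set xs \<subseteq> C" "y = sum_list xs" by blast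
    ultimately show "\<exists>xs. length xs = Suc k \<and> set xs \<subseteq> C \<and> v = sum_list xs"
      by (intro exI[of _ "x # xs"]) auto
  next
    assume "\<exists>xs. length xs = Suc k \<and> set xs \<subseteq> C \<and> v = sum_list xs"
    then obtain x xs where "length xs = k" "x \<in> C" "set xs \<subseteq> C" "v = x + sum_list xs"
      by (auto simp: length_Suc_conv)
    then show "v \<in> sums_of C (Suc k)" using Suc by (auto intro!: sumsetI)
  qed
qed auto

text \<open>Nondegeneracy makes the least length exist, and shorter sums are padded with 0.\<close>

lemma vector_rank_le_iff:
  assumes "nondegenerate_cone (affine_cone X)"
  shows "vector_rank X v \<le> k \<longleftrightarrow> v \<in> sums_of (affine_cone X) k"
proof -
  interpret nondegenerate_cone "affine_cone X" by fact
  have rank: "vector_rank X v = (LEAST k. v \<in> sums_of (affine_cone X) k)"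
    unfolding vector_rank_def mem_sums_of_iff ..
  have "v \<in> sums_of (affine_cone X) (vector_rank X v)"
    unfolding rank using exists_sum[of v] by (rule LeastI_ex)
  then show ?thesis
    using sums_of_mono[OF zero_mem, of "vector_rank X v" k] unfolding rank by (auto intro: Least_le)
qed

text \<open>Uniqueness for the definite description: two nonempty open sets meet, as the whole space
  is irreducible.\<close>

lemma generic_rank_eqI:
  fixes X :: "('a::field_char_0 ^ 'n::finite) set set"
  assumes "polyfun g" "g v0 \<noteq> 0" "\<And>v. g v \<noteq> 0 \<Longrightarrow> v \<noteq> 0 \<and> vector_rank X v = k"
  shows "generic_rank X = k"
  unfolding generic_rank_def
proof (rule the_equality)
  obtain G where G: "\<forall>v. mpoly_eval G v = g v" using polyfun_imp_mpoly[OF assms(1)] by blast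
  show "\<exists>U. affine_closed (- U) \<and> U \<noteq> {} \<and> U \<subseteq> {v. v \<noteq> 0 \<and> vector_rank X v = k}"
  proof (intro exI[of _ "{v. g v \<noteq> 0}"] conjI)
    show "affine_closed (- {v. g v \<noteq> 0})"
      unfolding affine_closed_def by (rule exI[of _ "{G}"]) (use G in auto)
  qed (use assms in auto)
  fix r assume "\<exists>U. affine_closed (- U) \<and> U \<noteq> {} \<and> U \<subseteq> {v. v \<noteq> 0 \<and> vector_rank X v = r}"
  then obtain U where U: "affine_closed (- U)" "U \<noteq> {}" "U \<subseteq> {v. v \<noteq> 0 \<and> vector_rank X v = r}"
    by blast
  then obtain S where S: "- U = {v. \<forall>f\<in>S. mpoly_eval f v = 0}" by (auto simp: affine_closed_def)
  obtain u where "u \<in> U" using U(2) by blast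
  then obtain F where F: "F \<in> S" "mpoly_eval F u \<noteq> 0" using S by blast
  have "\<not> vanishes_on (\<lambda>z. g z * mpoly_eval F z) UNIV"
    using irreducible_set_mult[OF irreducible_set_UNIV assms(1) polyfun_mpoly_eval] assms(2) F(2)
    by blast
  then obtain z where z: "g z \<noteq> 0" "mpoly_eval F z \<noteq> 0" by auto
  then have "z \<in> U" using S F(1) by blast
  then show "r = k" using U(3) assms(3)[OF z(1)] by auto
qed

lemma point_rep_mem:
  assumes "p \<in> projective_space"
  shows "point_rep p \<in> p" "point_rep p \<noteq> 0"
proof -
  obtain v where "p = vec.span {v}" "v \<noteq> 0" using assms by (auto simp: projective_space_def)
  then have "v \<in> p \<and> v \<noteq> 0" by (simp add: vec.span_base)
  from someI[of "\<lambda>v. v \<in> p \<and> v \<noteq> 0", OF this]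
  show "point_rep p \<in> p" "point_rep p \<noteq> 0" by (auto simp: point_rep_def)
qed

lemma max_rank_leI:
  fixes X :: "('a::field ^ 'n::finite) set set"
  assumes "\<And>p. p \<in> projective_space \<Longrightarrow> point_rank X p \<le> k"
  shows "max_rank X \<le> k"
proof -
  have "point_rank X ` projective_space \<subseteq> {..k}" using assms by auto
  \<comment> \<open>Without finiteness \<open>Max\<close> would not be the maximum.\<close>
  then have "finite (point_rank X ` projective_space)" by (rule finite_subset) simp
  moreover have "projective_space \<noteq> ({} :: ('a ^ 'n) set set)"
    using span_mem_projective_space[of "axis undefined 1"] by (auto simp: axis_eq_0_iff)
  ultimately show ?thesis unfolding max_rank_def using assms by auto
qed

text \<open>The projective hull is cut out by forms, the affine closure by all polynomial functions.
  They match because the sums form a cone, so components of an equation are equations; at the apex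
  \<open>D \<ge> 1\<close> is used.\<close>

lemma secant_closure:
  fixes X :: "('a::{alg_closed_field, field_char_0} ^ 'n::finite) set set"
  assumes X: "irreducible_projective_variety X" "nondegenerate X"
    and F: "homogeneous_mpoly D F" "D \<ge> 1" "secant_variety X r = projective_zeros {F}"
  shows "zariski_closure (sums_of (affine_cone X) r) = {v. mpoly_eval F v = 0}"
proof -
  have nd: "nondegenerate_cone (affine_cone X)" by (rule nondegenerate_affine_cone[OF X])
  interpret nondegenerate_cone "affine_cone X" by fact
  let ?S = "sums_of (affine_cone X) r"
  note sub = variety_subset[OF X(1)]
  have point: "point_rank X (vec.span {v}) \<le> r \<longleftrightarrow> v \<in> ?S" if "v \<noteq> 0" for v
    using point_rank_eq_vector_rank[OF sub span_mem_projective_space[OF that], of v] that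
      vector_rank_le_iff[OF nd] by (simp add: vec.span_base)
  have hull: "{p \<in> projective_space. point_rank X p \<le> r} \<subseteq> secant_variety X r"
    unfolding secant_variety_def by (rule hull_subset)
  have F0: "mpoly_eval F 0 = 0"
    by (rule homogeneous_eval_zero[OF F(1,2)])
  have zero_S: "0 \<in> ?S" using sums_of_mono[OF zero_mem, of 0 r] by auto
  have van: "mpoly_eval F s = 0" if "s \<in> ?S" for s
  proof (cases "s = 0")
    case False
    then have "vec.span {s} \<in> projective_zeros {F}"
      using hull that point span_mem_projective_space[OF False] F(3) by auto
    then show ?thesis using span_mem_projective_zeros[of "{F}" s] F(1) False by auto
  qed (simp add: F0)
  show ?thesis
  proof (intro equalityI subsetI)
    fix v assume "v \<in> zariski_closure ?S"
    then have "mpoly_eval F v = 0" by (rule zariski_closureD[OF _ polyfun_mpoly_eval]) (use van in blast)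
    then show "v \<in> {v. mpoly_eval F v = 0}" by simp
  next
    fix v assume "v \<in> {v. mpoly_eval F v = 0}"
    then have v: "mpoly_eval F v = 0" by simp
    show "v \<in> zariski_closure ?S"
    proof (cases "v = 0")
      case True
      then show ?thesis using zero_S subset_zariski_closure by blast
    next
      case False
      then have vZ: "vec.span {v} \<in> secant_variety X r"
        using span_mem_projective_zeros[of "{F}" v] F v by auto
      show ?thesis
        unfolding zariski_closure_def
      proof (intro CollectI allI impI)
        fix f assume f: "polyfun f" "vanishes_on f ?S"
        have "homog_comp j f v = 0" for j
        proof -
          obtain G where G: "homogeneous_mpoly j G" "\<forall>v. mpoly_eval G v = homog_comp j f v"
            by (rule homog_comp_mpoly[OF f(1)])
          have "{p \<in> projective_space. point_rank X p \<le> r} \<subseteq> projective_zeros {G}"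
          proof
            fix p assume p: "p \<in> {p \<in> projective_space. point_rank X p \<le> r}"
            then obtain u where u: "u \<noteq> 0" "p = vec.span {u}" by (auto simp: projective_space_def)
            then have "u \<in> ?S" using p point by simp
            then have "homog_comp j f u = 0"
              using f(2) sums_of_scale[OF cone] by (intro homog_comp_eq_0[OF f(1)]) blast
            then show "p \<in> projective_zeros {G}"
              unfolding u(2) using span_mem_projective_zeros[of "{G}" u] G u(1) by auto
          qed
          then have "secant_variety X r \<subseteq> projective_zeros {G}"
            unfolding secant_variety_def by (rule hull_minimal) (rule projective_closed_single[OF G(1)])
          then have "mpoly_eval G v = 0"
            using vZ span_mem_projective_zeros[of "{G}" v] G(1) False by auto
          then show ?thesis using G(2) by simp
        qed
        moreover obtain E where "f v = (\<Sum>j\<le>E. homog_comp j f v)"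
          using homog_comp_sum[OF f(1)] by blast
        ultimately show "f v = 0" by simp
      qed
    qed
  qed
qed

theorem theorem6:
  fixes X :: "('a::{alg_closed_field, field_char_0} ^ 'n::finite) set set" and r :: nat
  assumes "irreducible_projective_variety X"
    and "nondegenerate X"
    and "\<not> projective_hypersurface X"
    and "r \<ge> 1"
    and "projective_hypersurface (secant_variety X r)"
  shows "r + 1 = generic_rank X
    \<and> max_rank X \<le> 2 * r + 1
    \<and> 2 * r + 1 = 2 * generic_rank X - 1
    \<and> ((\<nexists>p. p \<in> secant_variety X r
            \<and> hypersurface_multiplicity (secant_variety X r) p + 1
                = hypersurface_degree (secant_variety X r))
        \<longrightarrow> max_rank X \<le> 2 * r \<and> 2 * r = 2 * generic_rank X - 2)"
proof -
  let ?Z = "secant_variety X r"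
  let ?C = "affine_cone X"
  let ?S = "sums_of ?C r"
  obtain D F0 where F0: "D \<ge> 1" "homogeneous_mpoly D F0" "F0 \<noteq> 0" "?Z = projective_zeros {F0}"
    using assms(5) by (auto simp: projective_hypersurface_def)
  note sub = variety_subset[OF assms(1)]
  have nd: "nondegenerate_cone ?C" by (rule nondegenerate_affine_cone[OF assms(1,2)])
  note closure = secant_closure[OF assms(1,2) F0(2,1,4)]
  have F0_nz: "\<exists>v. mpoly_eval F0 v \<noteq> 0" using mpoly_eval_eq_0_imp F0(3) by blast
  interpret secant_hypersurface ?C r "mpoly_eval F0" D
    unfolding secant_hypersurface_def secant_hypersurface_axioms_def
    using nd assms(4) F0 F0_nz closure homog_mpoly_eval[of D F0]
    by (auto simp: polyfun_mpoly_eval)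
  have coneZ: "affine_cone ?Z = {v. mpoly_eval F0 v = 0}"
  proof (rule set_eqI)
    fix v
    have "mpoly_eval F0 0 = 0" by (rule homogeneous_eval_zero[OF F0(2,1)])
    then show "v \<in> affine_cone ?Z \<longleftrightarrow> v \<in> {v. mpoly_eval F0 v = 0}"
      using mem_affine_cone_iff[of ?Z v] span_mem_projective_zeros[of "{F0}" v] F0(2,4)
        projective_zeros_subset[of "{F0}"] by (cases "v = 0") (auto simp: affine_cone_def)
  qed
  have ideal: "G \<in> vanishing_ideal ?Z \<longleftrightarrow> vanishes_on (mpoly_eval G) ?S" for G
    unfolding vanishing_ideal_def coneZ closure[symmetric]
    using subset_zariski_closure[of ?S] zariski_closureD[OF _ polyfun_mpoly_eval, of _ ?S G] by blast
  define E where "E = reduced_equation ?Z"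
  \<comment> \<open>Existence of a generator is what gives the choice in
    \<open>reduced_equation\<close> its defining property.\<close>
  have "\<exists>f. (\<exists>d. homogeneous_mpoly d f) \<and> vanishing_ideal ?Z = {g. f dvd g}"
  proof -
    obtain f d where f: "polyfun f" "homog d f" "vanishes_on f ?S"
      "\<And>g. polyfun g \<Longrightarrow> vanishes_on g ?S \<Longrightarrow> \<exists>q. polyfun q \<and> (\<forall>v. g v = q v * f v)"
      using equation_exists by blast
    obtain H where H: "\<forall>v. mpoly_eval H v = f v" using polyfun_imp_mpoly[OF f(1)] by blast
    then have "mpoly_eval H = f" by blast
    then have "homogeneous_mpoly d H" using f(2) homog_mpoly_eval[of d H] by simp
    moreover have "G \<in> vanishing_ideal ?Z \<longleftrightarrow> H dvd G" for G
    proof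
      assume "G \<in> vanishing_ideal ?Z"
      then obtain q where q: "polyfun q" "\<forall>v. mpoly_eval G v = q v * f v"
        using f(4)[OF polyfun_mpoly_eval, of G] by (auto simp: ideal)
      obtain Q where "\<forall>v. mpoly_eval Q v = q v" using polyfun_imp_mpoly[OF q(1)] by blast
      then have "G = H * Q" using q(2) H by (intro mpoly_eqI) (simp add: mpoly_eval_mult)
      then show "H dvd G" by simp
    next
      assume "H dvd G"
      then show "G \<in> vanishing_ideal ?Z"
        using f(3) H by (auto simp: ideal mpoly_eval_mult elim!: dvdE)
    qed
    ultimately show ?thesis by (intro exI[of _ H]) auto
  qed
  from someI_ex[OF this] obtain d where E: "homogeneous_mpoly d E"
    "vanishing_ideal ?Z = {g. E dvd g}"
    unfolding E_def reduced_equation_def by blast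
  have dvd_iff: "E dvd G \<longleftrightarrow> vanishes_on (mpoly_eval G) ?S" for G
    using E(2) ideal by blast
  have "E \<noteq> 0"
  proof
    assume "E = 0"
    have "vanishes_on (mpoly_eval F0) ?S"
      using closure subset_zariski_closure[of ?S] by blast
    then have "E dvd F0" using dvd_iff by blast
    then show False using \<open>E = 0\<close> F0(3) by simp
  qed
  interpret secant_equation ?C r "mpoly_eval F0" D "mpoly_eval E" d
  proof unfold_locales
    show "polyfun (mpoly_eval E)" by (rule polyfun_mpoly_eval)
    show "homog d (mpoly_eval E)" using E(1) homog_mpoly_eval by blast
    show "vanishes_on (mpoly_eval E) ?S" using dvd_iff[of E] by simp
    show "\<exists>v. mpoly_eval E v \<noteq> 0" using mpoly_eval_eq_0_imp \<open>E \<noteq> 0\<close> by blast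
    fix g assume g: "polyfun g" "vanishes_on g ?S"
    obtain G where G: "\<forall>v. mpoly_eval G v = g v" using polyfun_imp_mpoly[OF g(1)] by blast
    then have "E dvd G" using g(2) by (simp add: dvd_iff)
    then obtain Q where Q: "G = E * Q" by (elim dvdE)
    have "g v = mpoly_eval Q v * mpoly_eval E v" for v
      using G[rule_format, of v] by (simp add: Q mpoly_eval_mult mult.commute)
    then show "\<exists>q. polyfun q \<and> (\<forall>v. g v = q v * mpoly_eval E v)"
      using polyfun_mpoly_eval[of Q] by blast
  qed
  have generic: "generic_rank X = r + 1"
  proof -
    obtain g where g: "polyfun g" "\<exists>v. g v \<noteq> 0" "\<forall>v. g v \<noteq> 0 \<longrightarrow> v \<in> sums_of ?C (Suc r)"
      by (rule open_next)
    \<comment> \<open>Where \<open>g\<close> is nonzero the rank is at most \<open>r + 1\<close>;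
      where \<open>E\<close> is nonzero it exceeds \<open>r\<close> and the vector is not 0.\<close>
    have "\<not> vanishes_on (\<lambda>v. g v * mpoly_eval E v) UNIV"
      using irreducible_set_mult[OF irreducible_set_UNIV g(1) f(1)] g(2) f(4) by blast
    then obtain v0 where v0: "g v0 * mpoly_eval E v0 \<noteq> 0" by blast
    show ?thesis
    proof (rule generic_rank_eqI[where g = "\<lambda>v. g v * mpoly_eval E v", OF _ v0])
      show "polyfun (\<lambda>v. g v * mpoly_eval E v)" by (intro polyfun_intros g f)
      fix v assume v: "g v * mpoly_eval E v \<noteq> 0"
      then have "vector_rank X v \<le> r + 1" using g(3) vector_rank_le_iff[OF nd] by auto
      moreover have "\<not> vector_rank X v \<le> r" using v f(3) vector_rank_le_iff[OF nd] by auto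
      ultimately show "v \<noteq> 0 \<and> vector_rank X v = r + 1" using v f_zero by auto
    qed
  qed
  have odd: "max_rank X \<le> 2 * r + 1"
    by (rule max_rank_leI) (use mem_sums_odd vector_rank_le_iff[OF nd] in \<open>simp add: point_rank_def\<close>)
  have even: "max_rank X \<le> 2 * r"
    if no_mult: "\<nexists>p. p \<in> ?Z \<and> hypersurface_multiplicity ?Z p + 1 = hypersurface_degree ?Z"
  proof (rule max_rank_leI)
    fix p :: "('a ^ 'n) set" assume p: "p \<in> projective_space"
    let ?q = "point_rep p"
    have "?q \<in> sums_of ?C (2 * r)"
    proof (rule mem_sums_even, rule notI)
      assume "\<exists>f1. polyfun f1 \<and> homog (d - 1) f1 \<and> (\<exists>v. f1 v \<noteq> 0) \<and>
        (\<forall>x. mpoly_eval E (?q + x) = mpoly_eval E x + f1 x)"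
      then obtain f1 where f1: "polyfun f1" "homog (d - 1) f1" "\<exists>v. f1 v \<noteq> 0"
        "\<forall>x. mpoly_eval E (?q + x) = mpoly_eval E x + f1 x" by blast
      obtain F1 where F1: "\<forall>v. mpoly_eval F1 v = f1 v" using polyfun_imp_mpoly[OF f1(1)] by blast
      then have F1_eq: "mpoly_eval F1 = f1" by blast
      have "homogeneous_mpoly (d - 1) F1" using f1(2) homog_mpoly_eval[of "d - 1" F1] F1_eq by simp
      moreover have "F1 \<noteq> 0" using f1(3) F1 by auto
      ultimately have "vanishing_order E ?q = d - 1"
        using vanishing_order_two_terms[OF E(1) _ \<open>E \<noteq> 0\<close>, of F1 ?q] d_pos f1(4) F1 by simp
      moreover have "mpoly_degree E = d" by (rule mpoly_degree_homogeneous[OF E(1) \<open>E \<noteq> 0\<close>])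
      ultimately have "hypersurface_multiplicity ?Z p + 1 = hypersurface_degree ?Z"
        using d_pos by (simp add: hypersurface_multiplicity_def hypersurface_degree_def E_def)
      \<comment> \<open>The hypothesis concerns only points of the hypersurface. As
        \<open>f1\<close> has positive degree, it vanishes at 0, and so \<open>E\<close> vanishes at
        the representative of \<open>p\<close>.\<close>
      moreover have "p \<in> ?Z"
      proof -
        have "f1 (0 *s 0) = 0 ^ (d - 1) * f1 0" using f1(2) unfolding homog_def by blast
        then have "f1 0 = 0" using degree_ge_2 by (simp add: power_0_left split: if_splits)
        then have "mpoly_eval E ?q = 0" using f1(4)[rule_format, of 0] f_zero by simp
        then have "mpoly_eval F0 ?q = 0" using closure_iff closure by blast
        moreover have "p = vec.span {?q}" by (rule span_eq_of_mem[OF p point_rep_mem[OF p]])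
        ultimately show ?thesis
          using span_mem_projective_zeros[of "{F0}" ?q] F0(2,4) point_rep_mem(2)[OF p] by auto
      qed
      ultimately show False using no_mult by blast
    qed
    then show "point_rank X p \<le> 2 * r" using vector_rank_le_iff[OF nd] by (simp add: point_rank_def)
  qed
  show ?thesis using generic odd even by simp
qed

end
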